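(* Let $d$ and $k$ be positive integers, and let $X\subset\mathbb{P}^n_{\mathbb{C}}$ be a smooth degree $d$ hypersurface. If $$n\geq \binom{d+k-1}{k}+k-1,$$ then the rational transformation $$\Phi:\mathbb{G}(k,n)\dashrightarrow \mathbb{P}^{N_d}/\!/\mathbf{PGL}_{k+1},\qquad [\Lambda]\mapsto [\Lambda\cap X\subset\Lambda],$$ is dominant.
   Context: $\mathbb{G}(k,n)$ is the Grassmannian parametrizing linear subspaces $\Lambda\cong\mathbb{P}^k$ of $\mathbb{P}^n$. $\mathbb{P}^{N_d}=\mathbb{P}H^0(\mathbb{P}^k,\mathcal{O}(d))$, with $N_d=\binom{d+k}{k}-1$, is the parameter space for degree $d$ hypersurfaces in $\mathbb{P}^k$, with the natural action of $\mathbf{PGL}_{k+1}$ (change of coordinates). $\mathbb{P}^{N_d}/\!/\mathbf{PGL}_{k+1}$ is the GIT quotient, i.e. the moduli space of semistable degree $d$ hypersurfaces in $\mathbb{P}^k$. The map $\Phi$ is defined on the open set of those $[\Lambda]$ for which $\Lambda\not\subset X$ and $\Lambda\cap X$ is a semistable degree $d$ hypersurface in $\Lambda\cong\mathbb{P}^k$; it sends such $[\Lambda]$ to the moduli point of $\Lambda\cap X\subset\Lambda$ (independent of the choice of isomorphism $\Lambda\cong\mathbb{P}^k$). Dominant means that the image of this open set is dense in the target. *)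

theory Defs
  imports
    "HOL-Analysis.Analysis"
    "HOL-Algebra.Ideal"
    "HOL-Library.Poly_Mapping"
begin

section \<open>Complex polynomials in variables indexed by a type\<close>

text \<open>
  A polynomial over the complex numbers with variables indexed by \<open>'v\<close> maps exponent vectors to
  coefficients; its ring structure is the one of \<^theory>\<open>HOL-Library.Poly_Mapping\<close>.
\<close>

type_synonym 'v monomial = "'v \<Rightarrow>\<^sub>0 nat"
type_synonym 'v mpoly = "'v monomial \<Rightarrow>\<^sub>0 complex"

definition mdeg :: "'v monomial \<Rightarrow> nat" where
  "mdeg m = (\<Sum>i\<in>Poly_Mapping.keys m. Poly_Mapping.lookup m i)"

text \<open>The zero polynomial is homogeneous of every degree.\<close>

definition homogeneous :: "nat \<Rightarrow> 'v mpoly \<Rightarrow> bool" where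
  "homogeneous d p \<longleftrightarrow> (\<forall>m\<in>Poly_Mapping.keys p. mdeg m = d)"

definition component :: "nat \<Rightarrow> 'v mpoly \<Rightarrow> 'v mpoly" where
  "component e p =
     (\<Sum>m | m \<in> Poly_Mapping.keys p \<and> mdeg m = e. Poly_Mapping.single m (Poly_Mapping.lookup p m))"

text \<open>
  The homomorphism that is \<open>c\<close> on coefficients and sends the variable \<open>i\<close> to \<open>\<sigma> i\<close>.
\<close>

definition mpoly_hom :: "(complex \<Rightarrow> 'r) \<Rightarrow> ('v \<Rightarrow> 'r) \<Rightarrow> 'v mpoly \<Rightarrow> 'r::comm_ring_1" where
  "mpoly_hom c \<sigma> p =
     (\<Sum>m\<in>Poly_Mapping.keys p. c (Poly_Mapping.lookup p m) *
        (\<Prod>i\<in>Poly_Mapping.keys m. \<sigma> i ^ Poly_Mapping.lookup m i))"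

definition eval :: "('v \<Rightarrow> complex) \<Rightarrow> 'v mpoly \<Rightarrow> complex" where
  "eval a p = mpoly_hom id a p"

definition subst :: "('v \<Rightarrow> 'w mpoly) \<Rightarrow> 'v mpoly \<Rightarrow> 'w mpoly" where
  "subst \<sigma> p = mpoly_hom (Poly_Mapping.single 0) \<sigma> p"

definition partial_deriv :: "'v \<Rightarrow> 'v mpoly \<Rightarrow> 'v mpoly" where
  "partial_deriv i p =
     (\<Sum>m\<in>Poly_Mapping.keys p. Poly_Mapping.single (m - Poly_Mapping.single i 1)
        (of_nat (Poly_Mapping.lookup m i) * Poly_Mapping.lookup p m))"

text \<open>
  The polynomial \<open>f(A y)\<close> in the variables \<open>y\<close>, i.e. the pullback of \<open>f\<close> along the linear map \<open>A\<close>.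
\<close>

definition pullback :: "complex ^ 'w ^ 'v \<Rightarrow> 'v mpoly \<Rightarrow> ('w::finite) mpoly" where
  "pullback A f = subst (\<lambda>i. \<Sum>j\<in>UNIV. Poly_Mapping.single (Poly_Mapping.single j 1) (A $ i $ j)) f"


section \<open>Hypersurfaces and linear subspaces of projective space\<close>

text \<open>
  Projective space with homogeneous coordinates indexed by \<open>'v\<close> is treated through its affine cone
  \<open>complex ^ 'v\<close>. A hypersurface of degree \<open>d\<close> is given by its equation, a nonzero form of degree \<open>d\<close>
  (a representative of a point of the projective space of such forms).
\<close>

definition zero_locus :: "('v::finite) mpoly \<Rightarrow> (complex ^ 'v) set" where
  "zero_locus F = {x. eval (\<lambda>i. x $ i) F = 0}"

definition hypersurface :: "nat \<Rightarrow> 'v mpoly \<Rightarrow> bool" where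
  "hypersurface d F \<longleftrightarrow> F \<noteq> 0 \<and> homogeneous d F"

definition smooth_hypersurface :: "nat \<Rightarrow> ('v::finite) mpoly \<Rightarrow> bool" where
  "smooth_hypersurface d F \<longleftrightarrow> hypersurface d F \<and>
     (\<forall>x\<in>zero_locus F. x \<noteq> 0 \<longrightarrow> (\<exists>i. eval (\<lambda>j. x $ j) (partial_deriv i F) \<noteq> 0))"

definition grassmannian :: "nat \<Rightarrow> (complex ^ 'v::finite) set set" where
  "grassmannian k = {L. vec.subspace L \<and> vec.dim L = k + 1}"


section \<open>The GIT quotient of the space of forms\<close>

text \<open>
  The homogeneous coordinate ring of the projective space of forms of degree \<open>d\<close> in variables
  \<open>'v\<close> has one variable for each monomial of degree \<open>d\<close>. An element of it is a polynomial \<open>Q\<close> with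
  variables indexed by monomials, and its value at the form \<open>f\<close> is \<open>eval (lookup f) Q\<close>.
\<close>

type_synonym 'v coeff_poly = "'v monomial mpoly"

definition coordinate_ring :: "nat \<Rightarrow> ('v coeff_poly) set" where
  "coordinate_ring d = {Q. \<forall>M\<in>Poly_Mapping.keys Q. \<forall>m\<in>Poly_Mapping.keys M. mdeg m = d}"

text \<open>
  As usual, the action of the projective linear group is linearised through the special linear
  group; both have the same orbits of projective points.
\<close>

definition invariants :: "nat \<Rightarrow> (('v::finite) coeff_poly) set" where
  "invariants d = {Q \<in> coordinate_ring d. \<forall>A :: complex ^ 'v ^ 'v. \<forall>f. det A = 1 \<longrightarrow> homogeneous d f \<longrightarrow>
     eval (Poly_Mapping.lookup (pullback A f)) Q = eval (Poly_Mapping.lookup f) Q}"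

definition invariant_ring :: "nat \<Rightarrow> (('v::finite) coeff_poly) ring" where
  "invariant_ring d =
     \<lparr>carrier = invariants d, monoid.mult = (*), one = 1, ring.zero = 0, add = (+)\<rparr>"

definition semistable :: "nat \<Rightarrow> ('v::finite) mpoly \<Rightarrow> bool" where
  "semistable d f \<longleftrightarrow> hypersurface d f \<and>
     (\<exists>e>0. \<exists>Q\<in>invariants d. homogeneous e Q \<and> eval (Poly_Mapping.lookup f) Q \<noteq> 0)"

text \<open>
  The quotient is Proj of the graded ring of invariants: the homogeneous prime ideals that do not
  contain the irrelevant ideal, with the Zariski topology generated by the basic open sets
  \<open>D\<^sub>+(Q)\<close> for \<open>Q\<close> homogeneous of positive degree.
\<close>

definition homogeneous_ideal :: "'v mpoly set \<Rightarrow> bool" where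
  "homogeneous_ideal P \<longleftrightarrow> (\<forall>Q\<in>P. \<forall>e. component e Q \<in> P)"

definition proj_points :: "('v mpoly) ring \<Rightarrow> 'v mpoly set set" where
  "proj_points R = {P. primeideal P R \<and> homogeneous_ideal P \<and>
     (\<exists>e>0. \<exists>Q\<in>carrier R. homogeneous e Q \<and> Q \<notin> P)}"

definition proj_basic_open :: "('v mpoly) ring \<Rightarrow> 'v mpoly \<Rightarrow> 'v mpoly set set" where
  "proj_basic_open R Q = {P \<in> proj_points R. Q \<notin> P}"

definition Proj :: "('v mpoly) ring \<Rightarrow> 'v mpoly set topology" where
  "Proj R = topology_generated_by
     {proj_basic_open R Q | Q e. Q \<in> carrier R \<and> e > 0 \<and> homogeneous e Q}"

definition git_quotient :: "nat \<Rightarrow> (('v::finite) coeff_poly) set topology" where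
  "git_quotient d = Proj (invariant_ring d)"

text \<open>
  The image of a semistable form under the quotient map: the homogeneous ideal generated by the
  homogeneous invariants that vanish at the form.
\<close>

definition moduli_point :: "nat \<Rightarrow> ('v::finite) mpoly \<Rightarrow> ('v coeff_poly) set" where
  "moduli_point d f =
     {Q \<in> invariants d. \<forall>e. eval (Poly_Mapping.lookup f) (component e Q) = 0}"


section \<open>The map to moduli\<close>

text \<open>
  The equation of the intersection of \<open>L\<close> with the hypersurface \<open>F\<close> in the homogeneous coordinates
  of some isomorphism of \<open>L\<close> with the standard projective space. A different isomorphism changes
  it by an invertible linear substitution, which affects neither semistability nor the moduli point.
\<close>

definition linear_section :: "('v::finite) mpoly \<Rightarrow> (complex ^ 'v) set \<Rightarrow> ('w::finite) mpoly" where
  "linear_section F L =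
     pullback (SOME A :: complex ^ 'w ^ 'v. inj ((*v) A) \<and> range ((*v) A) = L) F"

definition section_moduli ::
    "nat \<Rightarrow> nat \<Rightarrow> ('v::finite) mpoly \<Rightarrow> (complex ^ 'v) set \<rightharpoonup> (('w::finite) coeff_poly) set" where
  "section_moduli k d F L =
     (let f = linear_section F L :: 'w mpoly in
      if L \<in> grassmannian k \<and> \<not> L \<subseteq> zero_locus F \<and> semistable d f
      then Some (moduli_point d f) else None)"

end

theory Submission
  imports Defs
    "HOL-Computational_Algebra.Fundamental_Theorem_Algebra"
    "HOL-Library.Function_Algebras"
begin

text \<open>
  Let \<open>G\<^sub>0, \<dots>, G\<^sub>n\<close> be the partial derivatives of the equation \<open>F\<close> of \<open>X\<close>, forms of degree
  \<open>e = d - 1\<close> which by smoothness and Euler's identity have no common zero besides the origin. The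
  derivative at \<open>A\<close> of \<open>A \<mapsto> F \<circ> A\<close>, from linear maps to forms of degree \<open>d\<close> in \<open>k + 1\<close> variables, is
  \<open>B \<mapsto> \<Sum>i. (G\<^sub>i \<circ> A) * B\<^sub>i\<close>, where \<open>B\<^sub>i\<close> is the \<open>i\<close>-th coordinate of \<open>B\<close>. It is surjective as soon as
  the \<open>G\<^sub>i \<circ> A\<close> span all forms of degree \<open>e\<close>; if this happens for one \<open>A\<close>, no nonzero polynomial in
  the coefficients of a form, in particular no invariant, vanishes at all \<open>F \<circ> A\<close>, which is
  dominance.

  Assume that the \<open>G\<^sub>i \<circ> A\<close> never span. Then for an \<open>A\<close> with span of maximal dimension there is a functional \<open>\<psi>\<close> that
  annihilates them but not some power \<open>\<ell>\<^sup>e\<close> of a linear form, and \<open>A\<close> may be replaced by any nearby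
  \<open>A + a \<cdot> \<ell>\<close> with a vector \<open>a\<close>. Since \<open>G\<^sub>i \<circ> (A + a \<cdot> \<ell>) = G\<^sub>i(a) \<cdot> \<ell>\<^sup>e\<close> up to terms of degree less than
  \<open>e\<close> in \<open>a\<close>, the normalisation \<open>\<psi>(\<ell>\<^sup>e) = 1\<close> expresses every \<open>G\<^sub>i(a)\<close> through polynomials of degree
  less than \<open>e\<close>, linearly in the remaining coordinates of \<open>\<psi>\<close>. So the \<open>n + 1\<close> coordinates of \<open>a\<close> are
  integral over these at most \<open>n\<close> coordinates of \<open>\<psi>\<close>, which contradicts their algebraic independence.
\<close>

abbreviation (input) lookup where "lookup \<equiv> Poly_Mapping.lookup"
abbreviation (input) keys where "keys \<equiv> Poly_Mapping.keys"
abbreviation (input) single where "single \<equiv> Poly_Mapping.single"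

section \<open>Polynomials\<close>

lemma mpoly_sum_singles: "p = (\<Sum>m\<in>keys p. single m (lookup p m))"
  by (rule poly_mapping_eqI)
    (simp add: lookup_sum lookup_single when_def not_in_keys_iff_lookup_eq_zero)

lemma mpoly_induct [case_names zero single add]:
  fixes p :: "'a \<Rightarrow>\<^sub>0 'b::comm_monoid_add"
  assumes "P 0" "\<And>m c. P (single m c)" "\<And>p q. P p \<Longrightarrow> P q \<Longrightarrow> P (p + q)"
  shows "P p"
proof -
  have "P (\<Sum>m\<in>A. single m (lookup p m))" if "finite A" for A
    using that by induction (simp_all add: assms)
  from this[of "keys p"] show ?thesis using mpoly_sum_singles[of p] by simp
qed

section \<open>Degrees of monomials and coefficients of products\<close>

lemma mdeg_superset: "finite K \<Longrightarrow> keys m \<subseteq> K \<Longrightarrow> mdeg m = (\<Sum>i\<in>K. lookup m i)"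
  unfolding mdeg_def by (rule sum.mono_neutral_left) (auto simp: in_keys_iff)

lemma mdeg_UNIV: "mdeg m = (\<Sum>i\<in>UNIV. lookup m (i::'v::finite))"
  by (rule mdeg_superset) auto

lemma mdeg_zero [simp]: "mdeg 0 = 0"
  by (simp add: mdeg_def)

lemma mdeg_single [simp]: "mdeg (single i n) = n"
  by (simp add: mdeg_def)

lemma mdeg_add: "mdeg (m + n) = mdeg m + mdeg n"
proof -
  let ?K = "keys m \<union> keys n"
  have "keys (m + n) \<subseteq> ?K" by (rule keys_add)
  then show ?thesis
    by (simp add: mdeg_superset[of ?K] lookup_add sum.distrib)
qed

lemma mdeg_eq_0_iff: "mdeg m = 0 \<longleftrightarrow> m = 0"
  by (auto simp: mdeg_def in_keys_iff intro: poly_mapping_eqI)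

text \<open>Both summands are bounded by \<open>m\<close> at every variable, so they vanish outside
  \<open>keys m\<close>. The type of variables may be infinite: later the variables are monomials
  themselves.\<close>

lemma finite_add_decompositions: "finite {(k, l). k + l = (m :: 'v monomial)}"
proof -
  let ?r = "\<lambda>k. restrict (lookup k) (keys m)"
  let ?A = "{k. \<forall>i. lookup k i \<le> lookup m i}"
  have "inj_on ?r ?A"
  proof (rule inj_onI, rule poly_mapping_eqI)
    fix k l i assume *: "k \<in> ?A" "l \<in> ?A" "?r k = ?r l"
    show "lookup k i = lookup l i"
    proof (cases "i \<in> keys m")
      case True then show ?thesis using fun_cong[OF *(3), of i] by simp
    next
      case False
      then have "lookup m i = 0" by (simp add: in_keys_iff)
      moreover have "lookup k i \<le> lookup m i" "lookup l i \<le> lookup m i"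
        using *(1,2) by blast+
      ultimately show ?thesis by simp
    qed
  qed
  moreover have "?r ` ?A \<subseteq> (\<Pi>\<^sub>E i\<in>keys m. {..lookup m i})" by auto
  moreover have "finite (\<Pi>\<^sub>E i\<in>keys m. {..lookup m i})" by (simp add: finite_PiE)
  ultimately have fin: "finite ?A" by (meson finite_imageD finite_subset)
  have "{(k, l). k + l = m} \<subseteq> ?A \<times> ?A"
    by (auto simp: lookup_add)
  then show ?thesis using fin by (meson finite_SigmaI finite_subset)
qed

text \<open>Convolution over a finite index set: through it continuity, differentiability and degree
  bounds of coefficients pass from factors to products.\<close>

lemma lookup_mult_decompositions:
  fixes p q :: "'v mpoly"
  shows "lookup (p * q) m = (\<Sum>z | fst z + snd z = m. lookup p (fst z) * lookup q (snd z))"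
proof -
  have fin: "finite {z. fst z + snd z = m}"
    using finite_add_decompositions[of m] by (simp only: case_prod_unfold)
  show ?thesis
  proof (induction p rule: mpoly_induct)
    case (single k a)
    show ?case
    proof (induction q rule: mpoly_induct)
      case (single l b)
      have "(\<Sum>z | fst z + snd z = m. lookup (single k a) (fst z) * lookup (single l b) (snd z))
          = (\<Sum>z | fst z + snd z = m. if z = (k, l) then a * b else 0)"
        by (rule sum.cong) (auto simp: lookup_single when_def)
      also have "\<dots> = (if k + l = m then a * b else 0)" using fin by (simp add: sum.delta)
      finally show ?case by (auto simp: mult_single lookup_single when_def)
    qed (simp_all add: distrib_left lookup_add sum.distrib)
  qed (simp_all add: distrib_right lookup_add sum.distrib)
qed

lemma lookup_smult [simp]: "lookup (single 0 c * p) m = c * lookup p (m :: 'v monomial)"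
  by (simp flip: mult_map_scale_conv_mult add: map.rep_eq when_def)

section \<open>Evaluation and substitution homomorphisms\<close>

definition monom_eval :: "('v \<Rightarrow> 'r) \<Rightarrow> 'v monomial \<Rightarrow> 'r::comm_ring_1" where
  "monom_eval \<sigma> m = (\<Prod>i\<in>keys m. \<sigma> i ^ lookup m i)"

lemma monom_eval_superset:
  "finite K \<Longrightarrow> keys m \<subseteq> K \<Longrightarrow> monom_eval \<sigma> m = (\<Prod>i\<in>K. \<sigma> i ^ lookup m i)"
  unfolding monom_eval_def by (rule prod.mono_neutral_left) (auto simp: in_keys_iff)

lemma monom_eval_add: "monom_eval \<sigma> (m + n) = monom_eval \<sigma> m * monom_eval \<sigma> n"
proof -
  let ?K = "keys m \<union> keys n"
  have "keys (m + n) \<subseteq> ?K" by (rule keys_add)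
  then show ?thesis
    by (simp add: monom_eval_superset[of ?K] lookup_add power_add prod.distrib)
qed

lemma monom_eval_zero [simp]: "monom_eval \<sigma> 0 = 1"
  by (simp add: monom_eval_def)

lemma monom_eval_single [simp]: "monom_eval \<sigma> (single i n) = \<sigma> i ^ n"
  by (cases "n = 0") (simp_all add: monom_eval_def)

lemma monom_eval_scale: "monom_eval (\<lambda>i. t * \<sigma> i) m = t ^ mdeg m * monom_eval \<sigma> m"
  by (simp add: monom_eval_def mdeg_def power_mult_distrib prod.distrib power_sum)

lemma monom_eval_hom:
  fixes h :: "'a::comm_ring_1 \<Rightarrow> 'c::comm_ring_1" and \<sigma> :: "'b \<Rightarrow> 'a"
  assumes "\<And>x y. h (x * y) = h x * h y" "h 1 = 1"
  shows "h (monom_eval \<sigma> m) = monom_eval (\<lambda>i. h (\<sigma> i)) m"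
proof -
  have pow: "h (x ^ n) = h x ^ n" for x n by (induction n) (simp_all add: assms)
  have "h (prod f A) = (\<Prod>x\<in>A. h (f x))" for f :: "'b \<Rightarrow> 'a" and A
    by (induction A rule: infinite_finite_induct) (simp_all add: assms)
  then show ?thesis by (simp add: monom_eval_def pow)
qed

text \<open>The homomorphism laws are proved once for three instances: the identity gives
  \<open>eval\<close>, the embedding of constants gives \<open>subst\<close>, and constants in one
  variable give the restriction to a ray.\<close>

locale coeff_hom =
  fixes c :: "complex \<Rightarrow> 'r::comm_ring_1"
  assumes c_add: "c (x + y) = c x + c y" and c_mult: "c (x * y) = c x * c y" and c_one: "c 1 = 1"
begin

lemma c_zero [simp]: "c 0 = 0"
  using c_add[of 0 0] by simp

lemma mpoly_hom_superset:
  assumes "finite K" "keys p \<subseteq> K"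
  shows "mpoly_hom c \<sigma> p = (\<Sum>m\<in>K. c (lookup p m) * monom_eval \<sigma> m)"
  unfolding mpoly_hom_def monom_eval_def
  by (rule sum.mono_neutral_left) (use assms in \<open>auto simp: in_keys_iff\<close>)

lemma mpoly_hom_add: "mpoly_hom c \<sigma> (p + q) = mpoly_hom c \<sigma> p + mpoly_hom c \<sigma> q"
proof -
  let ?K = "keys p \<union> keys q"
  have "keys (p + q) \<subseteq> ?K" by (rule keys_add)
  then show ?thesis
    by (simp add: mpoly_hom_superset[of ?K] lookup_add c_add distrib_right sum.distrib)
qed

lemma mpoly_hom_zero: "mpoly_hom c \<sigma> 0 = 0"
  by (simp add: mpoly_hom_def)

lemma mpoly_hom_single: "mpoly_hom c \<sigma> (single m a) = c a * monom_eval \<sigma> m"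
  by (subst mpoly_hom_superset[of "{m}"]) auto

lemma mpoly_hom_one: "mpoly_hom c \<sigma> 1 = 1"
  using mpoly_hom_single[of \<sigma> 0 1] by (simp add: c_one)

lemma mpoly_hom_mult: "mpoly_hom c \<sigma> (p * q) = mpoly_hom c \<sigma> p * mpoly_hom c \<sigma> q"
proof (induction p rule: mpoly_induct)
  case (single m a)
  show ?case
    by (induction q rule: mpoly_induct)
      (simp_all add: mpoly_hom_zero mult_single mpoly_hom_single c_mult monom_eval_add
        distrib_left mpoly_hom_add mult.assoc mult.left_commute)
qed (simp_all add: mpoly_hom_zero mpoly_hom_add distrib_right)

lemma mpoly_hom_uminus: "mpoly_hom c \<sigma> (- p) = - mpoly_hom c \<sigma> p"
  using mpoly_hom_add[of \<sigma> p "- p"] by (simp add: mpoly_hom_zero eq_neg_iff_add_eq_0 add.commute)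

lemma mpoly_hom_diff: "mpoly_hom c \<sigma> (p - q) = mpoly_hom c \<sigma> p - mpoly_hom c \<sigma> q"
  using mpoly_hom_add[of \<sigma> p "- q"] by (simp add: mpoly_hom_uminus)

lemma mpoly_hom_sum: "mpoly_hom c \<sigma> (\<Sum>x\<in>A. f x) = (\<Sum>x\<in>A. mpoly_hom c \<sigma> (f x))"
  by (induction A rule: infinite_finite_induct) (simp_all add: mpoly_hom_zero mpoly_hom_add)

lemma mpoly_hom_power: "mpoly_hom c \<sigma> (p ^ n) = mpoly_hom c \<sigma> p ^ n"
  by (induction n) (simp_all add: mpoly_hom_one mpoly_hom_mult)

lemmas mpoly_hom_simps = mpoly_hom_zero mpoly_hom_one mpoly_hom_single mpoly_hom_add
  mpoly_hom_mult mpoly_hom_uminus mpoly_hom_diff mpoly_hom_sum mpoly_hom_power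

end

interpretation id_hom: coeff_hom id
  by unfold_locales simp_all

interpretation const_hom: coeff_hom "single (0 :: 'w monomial)"
  by unfold_locales (simp_all add: single_add mult_single)

lemmas eval_simps = id_hom.mpoly_hom_simps[folded eval_def, simplified]
lemmas subst_simps = const_hom.mpoly_hom_simps[folded subst_def]

lemma eval_superset:
  "finite K \<Longrightarrow> keys p \<subseteq> K \<Longrightarrow> eval a p = (\<Sum>m\<in>K. lookup p m * monom_eval a m)"
  unfolding eval_def by (simp add: id_hom.mpoly_hom_superset)

lemma eval_monom: "eval a (single m c) = c * monom_eval a m"
  by (simp add: eval_simps)

lemma eval_scale_homogeneous:
  assumes "homogeneous e p"
  shows "eval (\<lambda>i. t * a i) p = t ^ e * eval a p"
  using assms unfolding homogeneous_def
  by (simp add: eval_superset[OF finite_keys subset_refl] monom_eval_scale sum_distrib_left mult_ac)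

section \<open>Homogeneous polynomials and graded components\<close>

lemma homogeneous_zero [simp]: "homogeneous e 0"
  by (simp add: homogeneous_def)

lemma homogeneous_one [simp]: "homogeneous 0 1"
  by (simp add: homogeneous_def)

lemma homogeneous_add: "homogeneous e p \<Longrightarrow> homogeneous e q \<Longrightarrow> homogeneous e (p + q)"
  using keys_add[of p q] unfolding homogeneous_def by blast

lemma homogeneous_sum: "(\<And>x. x \<in> A \<Longrightarrow> homogeneous e (f x)) \<Longrightarrow> homogeneous e (\<Sum>x\<in>A. f x)"
  by (induction A rule: infinite_finite_induct) (simp_all add: homogeneous_add)

lemma homogeneous_single: "mdeg m = e \<Longrightarrow> homogeneous e (single m c)"
  by (simp add: homogeneous_def)

lemma homogeneous_mult:
  "homogeneous e p \<Longrightarrow> homogeneous e' q \<Longrightarrow> homogeneous (e + e') (p * q)"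
  using keys_mult[of p q] unfolding homogeneous_def by (force simp: mdeg_add)

lemma homogeneous_smult: "homogeneous e p \<Longrightarrow> homogeneous e (single 0 c * p)"
  using homogeneous_mult[of 0 "single 0 c" e p] by (simp add: homogeneous_single)

lemma homogeneous_power: "homogeneous e p \<Longrightarrow> homogeneous (n * e) (p ^ n)"
  by (induction n) (auto dest: homogeneous_mult)

lemma homogeneous_monom_eval:
  assumes "\<And>i. homogeneous 1 (\<sigma> i)"
  shows "homogeneous (mdeg m) (monom_eval \<sigma> m)"
proof -
  have "homogeneous (\<Sum>i\<in>A. lookup m i) (\<Prod>i\<in>A. \<sigma> i ^ lookup m i)" for A
    by (induction A rule: infinite_finite_induct)
      (use homogeneous_power[OF assms] in \<open>auto intro!: homogeneous_mult\<close>)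
  then show ?thesis by (simp add: mdeg_def monom_eval_def)
qed

lemma lookup_component: "lookup (component e p) m = (if mdeg m = e then lookup p m else 0)"
  unfolding component_def
  by (auto simp: lookup_sum lookup_single when_def not_in_keys_iff_lookup_eq_zero sum.delta' if_distrib cong: if_cong)

lemma homogeneous_component: "homogeneous e (component e p)"
  by (auto simp: homogeneous_def in_keys_iff lookup_component split: if_splits)

lemma component_add: "component e (p + q) = component e p + component e q"
  by (rule poly_mapping_eqI) (simp add: lookup_component lookup_add)

lemma component_diff: "component e (p - q) = component e p - component e q"
  by (rule poly_mapping_eqI) (simp add: lookup_component lookup_minus)

lemma component_zero [simp]: "component e 0 = 0"
  by (rule poly_mapping_eqI) (simp add: lookup_component)

lemma component_sum: "component e (\<Sum>x\<in>A. f x) = (\<Sum>x\<in>A. component e (f x))"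
  by (induction A rule: infinite_finite_induct) (simp_all add: component_add)

lemma component_homogeneous: "homogeneous e p \<Longrightarrow> component e' p = (if e' = e then p else 0)"
  by (rule poly_mapping_eqI) (auto simp: homogeneous_def lookup_component in_keys_iff)

text \<open>In the convolution only monomials of \<open>g\<close> of degree \<open>e\<close>
  contribute; the case distinction guards the truncated \<open>D - e\<close>. This serves to make
  the coefficients of ideal members homogeneous.\<close>

lemma component_mult_homogeneous:
  assumes "homogeneous e g"
  shows "component D (p * g) = (if e \<le> D then component (D - e) p * g else 0)"
proof (rule poly_mapping_eqI)
  fix m
  have z: "lookup g l = 0" if "mdeg l \<noteq> e" for l
    using assms that by (auto simp: homogeneous_def in_keys_iff)
  have "(\<Sum>z | fst z + snd z = m. lookup (component (D - e) p) (fst z) * lookup g (snd z))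
      = (\<Sum>z | fst z + snd z = m. lookup p (fst z) * lookup g (snd z))"
    if "e \<le> D" "mdeg m = D"
    by (rule sum.cong) (use that z in \<open>auto simp: lookup_component mdeg_add\<close>)
  moreover have "(\<Sum>z | fst z + snd z = m. lookup (component (D - e) p) (fst z) * lookup g (snd z)) = 0"
    if "e \<le> D" "mdeg m \<noteq> D"
    by (rule sum.neutral) (use that z in \<open>auto simp: lookup_component mdeg_add\<close>)
  moreover have "(\<Sum>z | fst z + snd z = m. lookup p (fst z) * lookup g (snd z)) = 0"
    if "\<not> e \<le> D" "mdeg m = D"
    by (rule sum.neutral) (use that z in \<open>auto simp: mdeg_add\<close>)
  ultimately show "lookup (component D (p * g)) m
      = lookup (if e \<le> D then component (D - e) p * g else 0) m"
    by (auto simp: lookup_component lookup_mult_decompositions)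
qed

text \<open>The exponents listed along an enumeration of the variables form a list of length
  \<open>CARD('v)\<close> with sum \<open>d\<close>; stars and bars counts these lists.\<close>

lemma finite_mdeg_eq: "finite {m :: 'v::finite monomial. mdeg m = d}"
  and card_mdeg_eq_le: "card {m :: 'v::finite monomial. mdeg m = d} \<le> (d + CARD('v) - 1) choose d"
proof -
  obtain xs :: "'v list" where xs: "set xs = UNIV" "distinct xs"
    using finite_distinct_list[OF finite_class.finite_UNIV] by blast
  then have len: "length xs = CARD('v)" using distinct_card by fastforce
  let ?f = "\<lambda>m :: 'v monomial. map (lookup m) xs"
  let ?L = "{l::nat list. length l = CARD('v) \<and> sum_list l = d}"
  have inj: "inj_on ?f {m. mdeg m = d}"
    using xs(1) by (auto intro!: inj_onI poly_mapping_eqI)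
  have im: "?f ` {m. mdeg m = d} \<subseteq> ?L"
    using xs by (auto simp: len mdeg_UNIV sum_list_distinct_conv_sum_set)
  have cL: "card ?L = (d + CARD('v) - 1) choose d" by (rule card_length_sum_list)
  have "d \<le> d + CARD('v) - 1" using zero_less_card_finite[where 'a='v] by linarith
  then have "0 < card ?L" using cL by (simp add: zero_less_binomial_iff)
  then have fL: "finite ?L" using card_ge_0_finite by blast
  show "finite {m :: 'v::finite monomial. mdeg m = d}"
    using finite_imageD[OF finite_subset[OF im fL] inj] .
  show "card {m :: 'v::finite monomial. mdeg m = d} \<le> (d + CARD('v) - 1) choose d"
    using card_mono[OF fL im] card_image[OF inj] cL by simp
qed

lemma finite_mdeg_le: "finite {m :: 'v::finite monomial. mdeg m \<le> d}"
proof -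
  have "{m :: 'v::finite monomial. mdeg m \<le> d} = (\<Union>e\<le>d. {m. mdeg m = e})" by auto
  then show ?thesis by (simp add: finite_mdeg_eq)
qed

section \<open>Derivatives\<close>

lemma partial_deriv_superset:
  assumes "finite K" "keys p \<subseteq> K"
  shows "partial_deriv i p = (\<Sum>m\<in>K. single (m - single i 1) (of_nat (lookup m i) * lookup p m))"
  unfolding partial_deriv_def
  by (rule sum.mono_neutral_left) (use assms in \<open>auto simp: in_keys_iff\<close>)

lemma partial_deriv_zero [simp]: "partial_deriv i 0 = 0"
  by (simp add: partial_deriv_def)

lemma partial_deriv_single:
  "partial_deriv i (single m c) = single (m - single i 1) (of_nat (lookup m i) * c)"
  by (subst partial_deriv_superset[of "{m}"]) auto

lemma partial_deriv_add: "partial_deriv i (p + q) = partial_deriv i p + partial_deriv i q"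
proof -
  let ?K = "keys p \<union> keys q"
  have "keys (p + q) \<subseteq> ?K" by (rule keys_add)
  then show ?thesis
    by (simp add: partial_deriv_superset[of ?K] lookup_add distrib_left single_add sum.distrib)
qed

lemma mono_minus_plus_single:
  fixes m :: "'v monomial"
  assumes "lookup m i \<noteq> 0" shows "m - single i 1 + single i 1 = m"
  by (rule poly_mapping_eqI) (use assms in \<open>auto simp: lookup_add lookup_minus lookup_single when_def\<close>)

lemma lookup_partial_deriv:
  "lookup (partial_deriv i p) m = of_nat (lookup m i + 1) * lookup p (m + single i 1)"
proof (induction p rule: mpoly_induct)
  case (single n c)
  show ?case
  proof (cases "lookup n i = 0")
    case True
    then have "n \<noteq> m + single i 1" by (auto simp: lookup_add)
    then show ?thesis using True by (simp add: partial_deriv_single lookup_single)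
  next
    case False
    have "n = m + single i 1 \<longleftrightarrow> n - single i 1 = m"
      using mono_minus_plus_single[OF False] by (metis add_diff_cancel_right')
    then show ?thesis
      using mono_minus_plus_single[OF False]
      by (simp add: partial_deriv_single lookup_single when_def del: of_nat_add One_nat_def)
        (metis add.commute lookup_add lookup_single_eq)
  qed
qed (simp_all add: partial_deriv_add lookup_add distrib_left)

lemma keys_partial_deriv: "m \<in> keys (partial_deriv i p) \<Longrightarrow> m + single i 1 \<in> keys p"
  by (auto simp: in_keys_iff lookup_partial_deriv)

lemma homogeneous_partial_deriv: "homogeneous d p \<Longrightarrow> homogeneous (d - 1) (partial_deriv i p)"
  unfolding homogeneous_def by (auto dest!: keys_partial_deriv simp: mdeg_add)

text \<open>When \<open>lookup m i = 0\<close> the truncated subtraction leaves \<open>m\<close>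
  unchanged; the factor \<open>of_nat (lookup m i)\<close> kills this case.\<close>

lemma monom_eval_partial:
  "of_nat (lookup m i) * \<sigma> i * monom_eval \<sigma> (m - single i 1) = of_nat (lookup m i) * monom_eval \<sigma> m"
proof (cases "lookup m i = 0")
  case False
  then show ?thesis
    using monom_eval_add[of \<sigma> "m - single i 1" "single i 1"] mono_minus_plus_single[OF False]
    by (simp add: mult_ac)
qed simp

text \<open>A monomial \<open>m\<close> is counted \<open>lookup m i\<close> times for the variable
  \<open>i\<close>, in total \<open>mdeg m = d\<close> times. For \<open>d > 0\<close> a common zero
  of the partial derivatives is thus a zero of \<open>p\<close>.\<close>

lemma euler_identity:
  fixes p :: "'v::finite mpoly"
  assumes "homogeneous d p"
  shows "(\<Sum>i\<in>UNIV. a i * eval a (partial_deriv i p)) = of_nat d * eval a p"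
proof -
  have "(\<Sum>i\<in>UNIV. a i * eval a (partial_deriv i p))
      = (\<Sum>i\<in>UNIV. \<Sum>m\<in>keys p. lookup p m * (of_nat (lookup m i) * a i * monom_eval a (m - single i 1)))"
    by (simp add: partial_deriv_def eval_simps sum_distrib_left mult.assoc mult.left_commute)
  also have "\<dots> = (\<Sum>m\<in>keys p. lookup p m * (\<Sum>i\<in>UNIV. of_nat (lookup m i)) * monom_eval a m)"
    by (subst sum.swap) (simp add: monom_eval_partial[unfolded mult.assoc One_nat_def]
          sum_distrib_left sum_distrib_right mult.assoc)
  also have "\<dots> = (\<Sum>m\<in>keys p. of_nat d * (lookup p m * monom_eval a m))"
    by (rule sum.cong)
      (use assms in \<open>auto simp: homogeneous_def mdeg_UNIV mult_ac simp flip: of_nat_sum\<close>)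
  finally show ?thesis
    by (simp add: eval_superset[OF finite_keys subset_refl] sum_distrib_left)
qed

section \<open>The homogeneous Nullstellensatz\<close>

lemma underdetermined_system:
  fixes M :: "'s \<Rightarrow> 't \<Rightarrow> 'f::field"
  assumes "finite T" "finite S" "card T < card S"
  shows "\<exists>x. (\<exists>s\<in>S. x s \<noteq> 0) \<and> (\<forall>t\<in>T. (\<Sum>s\<in>S. x s * M s t) = 0)"
  using assms
proof (induction T arbitrary: S M rule: finite_induct)
  case empty
  then show ?case by (intro exI[of _ "\<lambda>_. 1"]) (auto simp: card_gt_0_iff)
next
  case (insert t T)
  show ?case
  proof (cases "\<forall>s\<in>S. M s t = 0")
    case True
    have "card T < card S" using insert by simp
    from insert.IH[OF insert.prems(1) this, of M] show ?thesis using True by auto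
  next
    case False
    \<comment> \<open>Gaussian elimination: equation \<open>t\<close> is solved for the unknown
      \<open>r\<close>, whose coefficient is nonzero, and the result is substituted into the other
      equations.\<close>
    then obtain r where r: "r \<in> S" "M r t \<noteq> 0" by blast
    let ?S = "S - {r}"
    have "card T < card ?S" using insert r by simp
    from insert.IH[OF _ this, of "\<lambda>s u. M s u - M s t / M r t * M r u"] insert.prems(1)
    obtain x where x: "\<exists>s\<in>?S. x s \<noteq> 0"
      and x0: "\<And>u. u \<in> T \<Longrightarrow> (\<Sum>s\<in>?S. x s * (M s u - M s t / M r t * M r u)) = 0"
      by auto
    define c where "c = - (\<Sum>s\<in>?S. x s * M s t) / M r t"
    let ?y = "x(r := c)"
    have split: "(\<Sum>s\<in>S. ?y s * M s u) = c * M r u + (\<Sum>s\<in>?S. x s * M s u)" for u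
      using r(1) insert.prems(1) by (subst sum.remove[of _ r]) (auto intro: sum.cong)
    have "(\<Sum>s\<in>S. ?y s * M s u) = 0" if "u \<in> insert t T" for u
    proof (cases "u = t")
      case True
      then show ?thesis using r(2) by (simp only: split) (simp add: c_def)
    next
      case False
      have "(\<Sum>s\<in>?S. x s * M s u) = (\<Sum>s\<in>?S. x s * M s t) / M r t * M r u"
        using x0[of u] that False
        by (simp add: algebra_simps sum_subtractf sum_distrib_left sum_divide_distrib)
      then show ?thesis by (simp only: split) (simp add: c_def)
    qed
    moreover have "\<exists>s\<in>S. ?y s \<noteq> 0" using x by auto
    ultimately show ?thesis by blast
  qed
qed

text \<open>A ring as a module over itself: its subspaces are the ideals, and
  \<open>ideal.span\<close> is the ideal generated by a set.\<close>

interpretation ideal: module "(*) :: 'r::comm_ring_1 \<Rightarrow> 'r \<Rightarrow> 'r"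
  by unfold_locales (simp_all add: algebra_simps)

(* As a rewrite rule this would be associativity from right to left, looping with ring normalisation. *)
declare ideal.scale_scale [simp del]

text \<open>Zorn's lemma, with maximality recorded as invertibility modulo \<open>I\<close> of the
  elements outside \<open>I\<close>.\<close>

lemma maximal_ideal_exists:
  fixes J :: "'r::comm_ring_1 set"
  assumes "ideal.subspace J" "1 \<notin> J"
  obtains I where "ideal.subspace I" "J \<subseteq> I" "1 \<notin> I"
    "\<And>x. x \<notin> I \<Longrightarrow> \<exists>r. r * x - 1 \<in> I"
proof -
  let ?A = "{I. ideal.subspace I \<and> J \<subseteq> I \<and> 1 \<notin> I}"
  have "\<exists>M\<in>?A. \<forall>X\<in>?A. M \<subseteq> X \<longrightarrow> X = M"
  proof (rule subset_Zorn_nonempty)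
    show "?A \<noteq> {}" using assms by blast
    fix C assume C: "C \<noteq> {}" "subset.chain ?A C"
    have sub: "ideal.subspace I" "J \<subseteq> I" "1 \<notin> I" if "I \<in> C" for I
      using C(2) that by (auto simp: subset.chain_def)
    have "ideal.subspace (\<Union>C)"
    proof (rule ideal.subspaceI)
      show "0 \<in> \<Union>C" using C(1) sub(1) ideal.subspace_0 by blast
      show "c * x \<in> \<Union>C" if "x \<in> \<Union>C" for c x
        using that sub(1) ideal.subspace_scale by blast
      fix x y assume "x \<in> \<Union>C" "y \<in> \<Union>C"
      then obtain I K where IK: "I \<in> C" "x \<in> I" "K \<in> C" "y \<in> K" by blast
      then have "I \<subseteq> K \<or> K \<subseteq> I" using C(2) by (auto simp: subset.chain_def)
      then show "x + y \<in> \<Union>C" using IK sub(1) ideal.subspace_add by blast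
    qed
    then show "\<Union>C \<in> ?A" using C(1) sub by blast
  qed
  then obtain M where "M \<in> ?A" and max': "\<forall>X\<in>?A. M \<subseteq> X \<longrightarrow> X = M" by (rule bexE)
  then have M: "ideal.subspace M" "J \<subseteq> M" "1 \<notin> M" by auto
  have max: "X = M" if "ideal.subspace X" "1 \<notin> X" "M \<subseteq> X" for X
  proof -
    have "X \<in> ?A" using that M(2) by auto
    then show ?thesis using max' that(3) by blast
  qed
  have "\<exists>r. r * x - 1 \<in> M" if "x \<notin> M" for x
  proof -
    \<comment> \<open>By maximality this ideal is the whole ring; writing 1 as one of its elements
      yields the inverse of \<open>x\<close>.\<close>
    let ?X = "ideal.span (insert x M)"
    have "insert x M \<subseteq> ?X" by (rule ideal.span_superset)
    then have "1 \<in> ?X" using max[of ?X] that by blast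
    moreover have "ideal.span M = M" using M(1) by simp
    ultimately obtain k where "1 - k * x \<in> M" by (auto simp: ideal.span_insert)
    then have "- (1 - k * x) \<in> M" by (rule ideal.subspace_neg[OF M(1)])
    then show ?thesis by (intro exI[of _ k]) simp
  qed
  with M that show ?thesis by blast
qed

lemma single_mono_eq_monom_eval: "single m 1 = monom_eval (\<lambda>i. single (single i 1) (1::complex)) m"
proof -
  have pow: "(single (single i 1) (1::complex)) ^ n = single (single i n) 1" for i :: 'a and n
    by (induction n) (simp_all add: mult_single flip: single_add)
  have prd: "(\<Prod>i\<in>A. single (f i) (1::complex)) = single (\<Sum>i\<in>A. f i) 1" for f :: "'a \<Rightarrow> 'a monomial" and A
    by (induction A rule: infinite_finite_induct) (simp_all add: mult_single)
  show ?thesis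
    unfolding monom_eval_def by (simp only: pow prd mpoly_sum_singles[of m, symmetric])
qed

text \<open>
  The coefficient field is uncountable while the polynomial ring has countable dimension, so that
  the inverses of the elements \<open>x - z\<close> modulo a maximal ideal cannot be linearly independent.
\<close>

lemma maximal_ideal_residue:
  fixes I :: "'v::finite mpoly set"
  assumes I: "ideal.subspace I" and one: "1 \<notin> I"
    and inv: "\<And>x. x \<notin> I \<Longrightarrow> \<exists>r. r * x - 1 \<in> I"
  shows "\<exists>z. x - single 0 z \<in> I"
proof (rule ccontr)
  assume no: "\<nexists>z. x - single 0 z \<in> I"
  then have "\<exists>r. r * (x - single 0 z) - 1 \<in> I" for z using inv by blast
  then obtain r where r: "\<And>z. r z * (x - single 0 z) - 1 \<in> I" by metis
  \<comment> \<open>\<open>X q\<close> is the value of \<open>q\<close> at \<open>x\<close>; the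
    next facts make \<open>X\<close> a homomorphism of algebras.\<close>
  define X where "X q = poly (map_poly (single 0) q) x" for q :: "complex poly"
  have X_pCons: "X (pCons a q) = single 0 a + x * X q" for a q
    by (simp add: X_def map_poly_pCons)
  have X_0: "X 0 = 0" by (simp add: X_def)
  have X_add: "X (p + q) = X p + X q" for p q
    by (induction p q rule: poly_induct2) (simp_all add: X_0 X_pCons single_add algebra_simps)
  have X_smult: "X (Polynomial.smult a p) = single 0 a * X p" for a p
  proof (induction p)
    case (pCons b p)
    have "single 0 (a * b) = single 0 a * (single 0 b :: 'v mpoly)" by (simp add: mult_single)
    then show ?case using pCons by (simp add: X_pCons distrib_left mult.left_commute)
  qed (simp add: X_0)
  have X_mult: "X (p * q) = X p * X q" for p q
  proof (induction p)
    case (pCons a p)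
    then show ?case
      by (simp only: mult_pCons_left X_add X_smult X_pCons single_zero add_0_left distrib_right mult.assoc)
  qed (simp add: X_0)
  have X_1: "X 1 = 1" by (simp add: X_0 X_pCons one_pCons)
  have X_prod: "X (prod f A) = (\<Prod>a\<in>A. X (f a))" for f :: "complex \<Rightarrow> complex poly" and A
    by (induction A rule: infinite_finite_induct) (simp_all add: X_1 X_mult)
  have X_sum: "X (sum f A) = (\<Sum>a\<in>A. X (f a))" for f :: "complex \<Rightarrow> complex poly" and A
    by (induction A rule: infinite_finite_induct) (simp_all add: X_0 X_add)
  have X_lin: "X [:- z, 1:] = x - single 0 z" for z by (simp add: X_0 X_pCons single_uminus)
  have cancel: "y \<in> I" if "(x - single 0 z) * y \<in> I" for y z
  proof -
    have "r z * ((x - single 0 z) * y) - (r z * (x - single 0 z) - 1) * y \<in> I"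
      using ideal.subspace_diff[OF I ideal.subspace_scale[OF I that, of "r z"]
          ideal.subspace_scale[OF I r[of z], of y]] by (simp add: mult.commute)
    then show ?thesis by (simp add: left_diff_distrib right_diff_distrib mult.assoc)
  qed
  \<comment> \<open>Over the complex numbers \<open>q\<close> splits into linear factors, and each
    \<open>x - z\<close> can be cancelled modulo \<open>I\<close>; so \<open>x\<close> is
    transcendental modulo \<open>I\<close>.\<close>
  have notin: "X q \<notin> I" if "q \<noteq> 0" for q
    using that
  proof (induction "Polynomial.degree q" arbitrary: q)
    case 0
    then obtain c where c: "q = [:c:]" "c \<noteq> 0" by (metis degree_eq_zeroE pCons_0_0)
    show ?case
    proof
      assume "X q \<in> I"
      from ideal.subspace_scale[OF I this, of "single 0 (1 / c)"] show False
        using c one by (simp add: X_pCons X_0 mult_single)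
    qed
  next
    case (Suc n)
    then obtain z where "poly q z = 0"
      using fundamental_theorem_of_algebra[of q] by (auto simp: constant_degree)
    then obtain p where p: "q = [:- z, 1:] * p" by (auto simp: poly_eq_0_iff_dvd)
    then have "p \<noteq> 0" using Suc.prems by auto
    then have "Polynomial.degree q = Suc (Polynomial.degree p)"
      unfolding p by (subst degree_mult_eq) auto
    then have "n = Polynomial.degree p" using Suc.hyps(2) by simp
    note * = this \<open>p \<noteq> 0\<close>
    have "X p \<notin> I" using Suc.hyps(1)[OF *] .
    then show ?case using cancel unfolding p X_mult X_lin by blast
  qed
  \<comment> \<open>The countably many sets \<open>Z D\<close> exhaust the uncountable complex
    plane, so one of them is infinite, and its inverses \<open>r z\<close> lie in a space of finite
    dimension.\<close>
  define Z where "Z D = {z. \<forall>k\<in>keys (r z). mdeg k \<le> D}" for D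
  have "z \<in> (\<Union>D. Z D)" for z
    unfolding Z_def by (auto intro!: exI[of _ "\<Sum>k\<in>keys (r z). mdeg k"] member_le_sum)
  then have "uncountable (\<Union>D. Z D)" using uncountable_UNIV_complex by (metis UNIV_eq_I)
  then obtain D where "infinite (Z D)" by (meson countable_UN countable_finite countableI_type)
  let ?T = "{m :: 'v monomial. mdeg m \<le> D}"
  obtain L where L: "L \<subseteq> Z D" "finite L" "card L = Suc (card ?T)"
    using infinite_arbitrarily_large[OF \<open>infinite (Z D)\<close>] by blast
  obtain c z0 where c: "z0 \<in> L" "c z0 \<noteq> 0"
    and c0: "\<And>k. k \<in> ?T \<Longrightarrow> (\<Sum>z\<in>L. c z * lookup (r z) k) = 0"
    using underdetermined_system[OF finite_mdeg_le L(2), of D "\<lambda>z. lookup (r z)"] L(3) by auto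
  have dep: "(\<Sum>z\<in>L. single 0 (c z) * r z) = 0"
  proof (rule poly_mapping_eqI)
    fix k
    show "lookup (\<Sum>z\<in>L. single 0 (c z) * r z) k = lookup 0 k"
    proof (cases "k \<in> ?T")
      case False
      then have "k \<notin> keys (r z)" if "z \<in> L" for z
        using L(1) that by (auto simp: Z_def)
      then have "lookup (r z) k = 0" if "z \<in> L" for z
        using that by (simp add: in_keys_iff)
      then show ?thesis by (simp add: lookup_sum)
    qed (use c0 in \<open>simp add: lookup_sum\<close>)
  qed
  let ?P = "\<lambda>A. \<Prod>z\<in>A. [:- z, 1:] :: complex poly"
  \<comment> \<open>By \<open>dep\<close> the sum of \<open>c z / (x - z)\<close> over
    \<open>L\<close> is 0 modulo \<open>I\<close>; multiplying by all \<open>x - z\<close> turns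
    this into the polynomial relation \<open>X q \<in> I\<close>.\<close>
  define q where "q = (\<Sum>z\<in>L. Polynomial.smult (c z) (?P (L - {z})))"
  have "single 0 (c z) * X (?P (L - {z})) - single 0 (c z) * r z * X (?P L) \<in> I" if "z \<in> L" for z
  proof -
    have "X (?P L) = (x - single 0 z) * X (?P (L - {z}))"
      by (simp only: prod.remove[OF L(2) that] X_mult X_lin)
    then have "single 0 (c z) * X (?P (L - {z})) - single 0 (c z) * r z * X (?P L)
        = - (single 0 (c z) * X (?P (L - {z}))) * (r z * (x - single 0 z) - 1)"
      by (simp add: left_diff_distrib right_diff_distrib mult.assoc mult.left_commute)
    then show ?thesis using ideal.subspace_scale[OF I r] by metis
  qed
  then have "(\<Sum>z\<in>L. single 0 (c z) * X (?P (L - {z})) - single 0 (c z) * r z * X (?P L)) \<in> I"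
    by (rule ideal.subspace_sum[OF I])
  also have "(\<Sum>z\<in>L. single 0 (c z) * X (?P (L - {z})) - single 0 (c z) * r z * X (?P L))
      = X q - (\<Sum>z\<in>L. single 0 (c z) * r z) * X (?P L)"
    by (simp add: q_def X_sum X_smult sum_subtractf sum_distrib_right)
  finally have "X q \<in> I" by (simp add: dep)
  moreover have "q \<noteq> 0"
  proof -
    \<comment> \<open>At \<open>z0\<close> every summand except that of \<open>z0\<close> itself
      contains the factor \<open>z0 - z0\<close>, so \<open>poly q z0\<close> is a nonzero multiple
      of \<open>c z0\<close>.\<close>
    have pr: "(\<Prod>w\<in>L - {z}. z0 - w) = 0" if "z \<in> L - {z0}" for z
      using c(1) L(2) that by (intro prod_zero) auto
    have "poly q z0 = (\<Sum>z\<in>L. c z * (\<Prod>w\<in>L - {z}. z0 - w))"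
      by (simp add: q_def poly_sum poly_prod)
    also have "\<dots> = c z0 * (\<Prod>w\<in>L - {z0}. z0 - w)"
      using c(1) L(2) by (simp only: sum.remove) (simp add: pr del: Diff_iff)
    also have "\<dots> \<noteq> 0" using c L(2) by auto
    finally show ?thesis by auto
  qed
  ultimately show False using notin by blast
qed

text \<open>A maximal ideal containing \<open>J\<close> has the complex numbers as residue field, so
  the residues of the variables are the coordinates of a common zero.\<close>

lemma weak_nullstellensatz:
  fixes J :: "'v::finite mpoly set"
  assumes "ideal.subspace J" "1 \<notin> J"
  shows "\<exists>a. \<forall>p\<in>J. eval a p = 0"
proof -
  obtain I where I: "ideal.subspace I" "J \<subseteq> I" "1 \<notin> I"
    and inv: "\<And>x. x \<notin> I \<Longrightarrow> \<exists>r. r * x - 1 \<in> I"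
    using maximal_ideal_exists[OF assms] by blast
  have "\<exists>z. single (single i 1) 1 - single 0 z \<in> I" for i
    by (rule maximal_ideal_residue[OF I(1,3)]) (rule inv)
  then have "\<exists>a. \<forall>i. single (single i 1) 1 - single 0 (a i) \<in> I" by (intro choice allI)
  then obtain a where a: "\<And>i. single (single i 1) 1 - single 0 (a i) \<in> I" by blast
  \<comment> \<open>The polynomials congruent to their value at \<open>a\<close> are closed under
    sums and products and include constants and variables, hence are all polynomials.\<close>
  define E where "E = {p. p - single 0 (eval a p) \<in> I}"
  have const: "single 0 c \<in> E" for c
    using ideal.subspace_0[OF I(1)] by (simp add: E_def eval_simps)
  have add: "p + q \<in> E" if "p \<in> E" "q \<in> E" for p q
    using that ideal.subspace_add[OF I(1), of "p - single 0 (eval a p)" "q - single 0 (eval a q)"]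
    by (simp add: E_def eval_simps single_add add_diff_add)
  have mult: "p * q \<in> E" if "p \<in> E" "q \<in> E" for p q
  proof -
    have "q * (p - single 0 (eval a p)) + single 0 (eval a p) * (q - single 0 (eval a q)) \<in> I"
      using that ideal.subspace_add[OF I(1)] ideal.subspace_scale[OF I(1)] by (simp add: E_def)
    moreover have "single 0 (eval a (p * q)) = single 0 (eval a p) * (single 0 (eval a q) :: 'v mpoly)"
      by (simp add: eval_simps mult_single)
    ultimately show ?thesis
      by (simp add: E_def right_diff_distrib mult.commute)
  qed
  have one: "1 \<in> E" using const[of 1] by simp
  have pow: "p ^ n \<in> E" if "p \<in> E" for p n
    by (induction n) (use that mult one in auto)
  have prd: "prod f A \<in> E" if "\<And>i. f i \<in> E" for f :: "'v \<Rightarrow> 'v mpoly" and A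
    by (induction A rule: infinite_finite_induct) (use that mult one in auto)
  have mono: "single m 1 \<in> E" for m
  proof -
    have "single (single i 1) 1 \<in> E" for i using a by (simp add: E_def eval_simps)
    then have "monom_eval (\<lambda>i. single (single i 1) (1::complex)) m \<in> E"
      unfolding monom_eval_def by (intro prd pow)
    then show ?thesis by (simp only: single_mono_eq_monom_eval[of m])
  qed
  have all: "p \<in> E" for p
  proof (induction p rule: mpoly_induct)
    case (single m c)
    then show ?case using mult[OF const[of c] mono[of m]] by (simp add: mult_single)
  qed (use const[of 0] add in auto)
  have "eval a p = 0" if "p \<in> J" for p
  proof (rule ccontr)
    assume nz: "eval a p \<noteq> 0"
    have "p \<in> I" using that I(2) by blast
    moreover have "p - single 0 (eval a p) \<in> I" using all[of p] by (simp add: E_def)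
    ultimately have "p - (p - single 0 (eval a p)) \<in> I" by (rule ideal.subspace_diff[OF I(1)])
    then have "single 0 (1 / eval a p) * single 0 (eval a p) \<in> I"
      using ideal.subspace_scale[OF I(1)] by simp
    then show False using nz I(3) by (simp add: mult_single)
  qed
  then show ?thesis by blast
qed

text \<open>Some power of each variable lies in the ideal of the \<open>G i\<close>, and a monomial
  of large degree is divisible by one of these powers; graded components then make the coefficients
  homogeneous.\<close>

lemma homogeneous_nullstellensatz:
  fixes G :: "'i::finite \<Rightarrow> 'v::finite mpoly"
  assumes hom: "\<And>i. homogeneous e (G i)"
    and nz: "\<And>a j. a j \<noteq> 0 \<Longrightarrow> \<exists>i. eval a (G i) \<noteq> 0"
  obtains B where "e \<le> B"
    "\<And>m. B \<le> mdeg m \<Longrightarrow> \<exists>q. single m 1 = (\<Sum>i\<in>UNIV. q i * G i) \<and>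
       (\<forall>i. homogeneous (mdeg m - e) (q i))"
proof -
  define I where "I = range (\<lambda>q. \<Sum>i\<in>UNIV. q i * G i)"
  have I: "ideal.subspace I"
  proof (rule ideal.subspaceI)
    show "0 \<in> I" unfolding I_def by (rule image_eqI[of _ _ "\<lambda>_. 0"]) auto
    show "x + y \<in> I" if "x \<in> I" "y \<in> I" for x y
    proof -
      obtain q q' where "x = (\<Sum>i\<in>UNIV. q i * G i)" "y = (\<Sum>i\<in>UNIV. q' i * G i)"
        using \<open>x \<in> I\<close> \<open>y \<in> I\<close> unfolding I_def by blast
      then show ?thesis unfolding I_def
        by (intro image_eqI[of _ _ "\<lambda>i. q i + q' i"]) (auto simp: distrib_right sum.distrib)
    qed
    show "c * x \<in> I" if "x \<in> I" for c x
    proof -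
      obtain q where "x = (\<Sum>i\<in>UNIV. q i * G i)" using \<open>x \<in> I\<close> unfolding I_def by blast
      then show ?thesis unfolding I_def
        by (intro image_eqI[of _ _ "\<lambda>i. c * q i"]) (auto simp: sum_distrib_left mult_ac)
    qed
  qed
  have G_I: "G i \<in> I" for i
  proof -
    have "(\<Sum>j\<in>UNIV. (if j = i then 1 else 0) * G j) = (\<Sum>j\<in>UNIV. if j = i then G j else 0)"
      by (rule sum.cong) auto
    then show ?thesis
      unfolding I_def by (intro image_eqI[of _ _ "\<lambda>j. if j = i then 1 else 0"]) auto
  qed
  have comp: "component s (\<Sum>i\<in>UNIV. q i * G i)
      = (\<Sum>i\<in>UNIV. (if e \<le> s then component (s - e) (q i) else 0) * G i)" for s q
    by (auto simp: component_sum component_mult_homogeneous[OF hom] intro: sum.cong)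
  then have comp_I: "component s g \<in> I" if "g \<in> I" for s g
    using that unfolding I_def by fastforce
  have "\<exists>s. single (single j s) 1 \<in> I" for j
  proof -
    let ?X = "single (single j 1) (1::complex)"
    \<comment> \<open>The ideal generated by the \<open>G i\<close> and \<open>?X - 1\<close>: a
      zero of it would be a common zero of the \<open>G i\<close> with \<open>j\<close>-th
      coordinate 1.\<close>
    let ?J = "{p. \<exists>k. p - k * (?X - 1) \<in> I}"
    have "ideal.span I = I" using I by simp
    then have J: "?J = ideal.span (insert (?X - 1) I)" by (simp only: ideal.span_insert)
    have "1 \<in> ?J"
    proof (rule ccontr)
      assume "1 \<notin> ?J"
      then obtain a where a: "\<And>p. p \<in> ?J \<Longrightarrow> eval a p = 0"
        using weak_nullstellensatz[of ?J] unfolding J by blast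
      have sup: "insert (?X - 1) I \<subseteq> ?J" unfolding J by (rule ideal.span_superset)
      have "eval a (?X - 1) = 0" using a sup by blast
      then have "a j \<noteq> 0" by (auto simp: eval_simps)
      moreover have "eval a (G i) = 0" for i using a sup G_I by blast
      ultimately show False using nz by blast
    qed
    then obtain k where k: "1 - k * (?X - 1) \<in> I" by blast
    have hX: "homogeneous 1 ?X" by (simp add: homogeneous_single)
    have cs: "component s (1 - k * (?X - 1))
        = (if s = 0 then 1 else 0) + component s k - (if 1 \<le> s then component (s - 1) k * ?X else 0)" for s
      by (simp add: right_diff_distrib component_add component_diff
          component_mult_homogeneous[OF hX, unfolded One_nat_def] component_homogeneous[OF homogeneous_one])
    \<comment> \<open>Modulo \<open>I\<close>, the component of degree \<open>s > 0\<close> of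
      \<open>1 - k * (?X - 1)\<close> gives \<open>component s k = component (s - 1) k * ?X\<close>,
      starting from -1 in degree 0. Beyond the degree of \<open>k\<close> this leaves a power of
      \<open>?X\<close> in \<open>I\<close>.\<close>
    have pw: "component s k + ?X ^ s \<in> I" for s
    proof (induction s)
      case 0
      then show ?case using comp_I[OF k, of 0] unfolding cs by (simp add: add.commute)
    next
      case (Suc s)
      have "component (Suc s) k - component s k * ?X \<in> I"
        using comp_I[OF k, of "Suc s"] unfolding cs by simp
      moreover have "?X * (component s k + ?X ^ s) \<in> I"
        using Suc ideal.subspace_scale[OF I] by blast
      ultimately have "component (Suc s) k - component s k * ?X + ?X * (component s k + ?X ^ s) \<in> I"
        by (rule ideal.subspace_add[OF I])
      then show ?case by (simp add: distrib_left mult.commute)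
    qed
    let ?s = "Suc (\<Sum>m\<in>keys k. mdeg m)"
    have "component ?s k = 0"
    proof (rule poly_mapping_eqI)
      fix m
      have "mdeg m < ?s" if "m \<in> keys k"
        using that by (simp add: less_Suc_eq_le member_le_sum)
      then have "mdeg m = ?s \<Longrightarrow> lookup k m = 0" by (metis in_keys_iff less_irrefl)
      then show "lookup (component ?s k) m = lookup 0 m" by (simp add: lookup_component)
    qed
    moreover have "?X ^ n = single (single j n) 1" for n
      by (induction n) (simp_all add: mult_single flip: single_add)
    ultimately show ?thesis using pw[of ?s] by (metis add_0_left)
  qed
  then obtain s where s: "\<And>j. single (single j (s j)) 1 \<in> I" by metis
  \<comment> \<open>If every exponent were below \<open>s j\<close>, the degree would be below the
    sum of the \<open>s j\<close>; the summand \<open>e\<close> makes \<open>mdeg m - e\<close> a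
    true difference.\<close>
  let ?B = "e + (\<Sum>j\<in>UNIV. s j)"
  have "\<exists>q. single m 1 = (\<Sum>i\<in>UNIV. q i * G i) \<and> (\<forall>i. homogeneous (mdeg m - e) (q i))"
    if m: "?B \<le> mdeg m" for m
  proof -
    have "\<exists>j. s j \<le> lookup m j"
    proof (rule ccontr)
      assume "\<nexists>j. s j \<le> lookup m j"
      then have "(\<Sum>j\<in>UNIV. lookup m j) < (\<Sum>j\<in>UNIV. s j)"
        by (intro sum_strict_mono) (auto simp: not_le)
      then show False using m by (simp add: mdeg_UNIV)
    qed
    then obtain j where j: "s j \<le> lookup m j" by blast
    have "m = m - single j (s j) + single j (s j)"
      by (rule poly_mapping_eqI) (use j in \<open>auto simp: lookup_add lookup_minus lookup_single when_def\<close>)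
    then have "single m (1::complex) = single (m - single j (s j)) 1 * single (single j (s j)) 1"
      by (simp add: mult_single)
    then have "single m 1 \<in> I" using ideal.subspace_scale[OF I s] by simp
    then obtain q where q: "single m 1 = (\<Sum>i\<in>UNIV. q i * G i)" unfolding I_def by blast
    have "single m 1 = component (mdeg m) (single m (1::complex))"
      by (simp add: component_homogeneous[OF homogeneous_single])
    also have "\<dots> = (\<Sum>i\<in>UNIV. component (mdeg m - e) (q i) * G i)"
      using m by (simp add: q comp)
    finally show ?thesis
      by (intro exI[of _ "\<lambda>i. component (mdeg m - e) (q i)"] conjI allI homogeneous_component)
  qed
  with that[of ?B] show ?thesis using le_add1 by blast
qed

section \<open>Vanishing of polynomials along submersions\<close>

text \<open>The chain rule along a curve. A finite set \<open>V\<close> confines the variables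
  because the index type may be infinite, as for polynomials in the coefficients of forms.\<close>

lemma eval_has_field_derivative:
  assumes "finite V" "\<And>m. m \<in> keys p \<Longrightarrow> keys m \<subseteq> V"
    and u: "\<And>i. i \<in> V \<Longrightarrow> ((\<lambda>t. u t i) has_field_derivative u' i) (at z)"
  shows "((\<lambda>t. eval (u t) p) has_field_derivative
    (\<Sum>i\<in>V. eval (u z) (partial_deriv i p) * u' i)) (at z)"
proof -
  have mono: "((\<lambda>t. monom_eval (u t) m) has_field_derivative
      (\<Sum>i\<in>V. of_nat (lookup m i) * monom_eval (u z) (m - single i 1) * u' i)) (at z)"
    if m: "keys m \<subseteq> V" for m
  proof -
    have pow: "((\<lambda>t. u t i ^ lookup m i) has_field_derivative
        of_nat (lookup m i) * u z i ^ (lookup m i - 1) * u' i) (at z)" if "i \<in> V" for i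
      using DERIV_power[OF u[OF that], of "lookup m i"] by (simp add: mult_ac)
    have eq: "of_nat (lookup m i) * monom_eval (u z) (m - single i 1)
        = of_nat (lookup m i) * u z i ^ (lookup m i - 1) * (\<Prod>j\<in>V - {i}. u z j ^ lookup m j)"
      if "i \<in> V" for i
    proof -
      have "keys (m - single i 1) \<subseteq> V" using m by (auto simp: in_keys_iff lookup_minus)
      then have "monom_eval (u z) (m - single i 1) = (\<Prod>j\<in>V. u z j ^ lookup (m - single i 1) j)"
        using assms(1) by (simp add: monom_eval_superset)
      also have "\<dots> = u z i ^ (lookup m i - 1) * (\<Prod>j\<in>V - {i}. u z j ^ lookup (m - single i 1) j)"
        using assms(1) that by (subst prod.remove[of _ i]) (simp_all add: lookup_minus)
      also have "(\<Prod>j\<in>V - {i}. u z j ^ lookup (m - single i 1) j) = (\<Prod>j\<in>V - {i}. u z j ^ lookup m j)"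
        by (rule prod.cong) (auto simp: lookup_minus lookup_single when_def)
      finally show ?thesis by (simp add: mult_ac)
    qed
    have "((\<lambda>t. \<Prod>i\<in>V. u t i ^ lookup m i) has_field_derivative
      (\<Sum>i\<in>V. of_nat (lookup m i) * u z i ^ (lookup m i - 1) * u' i
        * (\<Prod>j\<in>V - {i}. u z j ^ lookup m j))) (at z)"
      by (rule has_field_derivative_prod) (rule pow)
    moreover have "(\<lambda>t. \<Prod>i\<in>V. u t i ^ lookup m i) = (\<lambda>t. monom_eval (u t) m)"
      by (intro ext) (rule monom_eval_superset[OF assms(1) m, symmetric])
    moreover have "(\<Sum>i\<in>V. of_nat (lookup m i) * u z i ^ (lookup m i - 1) * u' i
          * (\<Prod>j\<in>V - {i}. u z j ^ lookup m j))
        = (\<Sum>i\<in>V. of_nat (lookup m i) * monom_eval (u z) (m - single i 1) * u' i)"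
      by (rule sum.cong) (simp_all only: eq mult_ac)
    ultimately show ?thesis by simp
  qed
  have "((\<lambda>t. \<Sum>m\<in>keys p. lookup p m * monom_eval (u t) m) has_field_derivative
      (\<Sum>m\<in>keys p. lookup p m *
        (\<Sum>i\<in>V. of_nat (lookup m i) * monom_eval (u z) (m - single i 1) * u' i))) (at z)"
    by (intro DERIV_sum DERIV_cmult mono assms(2))
  moreover have "(\<lambda>t. \<Sum>m\<in>keys p. lookup p m * monom_eval (u t) m) = (\<lambda>t. eval (u t) p)"
    by (simp add: eval_superset[OF finite_keys subset_refl])
  moreover have "(\<Sum>m\<in>keys p. lookup p m *
        (\<Sum>i\<in>V. of_nat (lookup m i) * monom_eval (u z) (m - single i 1) * u' i))
      = (\<Sum>i\<in>V. eval (u z) (partial_deriv i p) * u' i)"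
    by (simp add: partial_deriv_def eval_simps sum_distrib_left sum_distrib_right mult_ac)
      (rule sum.swap)
  ultimately show ?thesis by simp
qed

text \<open>
  All partial derivatives of a polynomial vanishing along a submersion vanish along it as well, and
  they have smaller degree.
\<close>

lemma vanishing_along_submersion:
  fixes u :: "'b::topological_space \<Rightarrow> 'v \<Rightarrow> complex"
  assumes "open U" "U \<noteq> {}" "finite V"
    and submersion: "\<And>x j. x \<in> U \<Longrightarrow> j \<in> V \<Longrightarrow> \<exists>\<gamma>. isCont \<gamma> (0::complex) \<and> \<gamma> 0 = x \<and>
      (\<forall>i\<in>V. ((\<lambda>t. u (\<gamma> t) i) has_field_derivative (if i = j then 1 else 0)) (at 0))"
    and "\<And>m. m \<in> keys p \<Longrightarrow> keys m \<subseteq> V" "\<And>x. x \<in> U \<Longrightarrow> eval (u x) p = 0"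
  shows "p = 0"
proof -
  have "p = 0" if "\<And>m. m \<in> keys p \<Longrightarrow> keys m \<subseteq> V \<and> mdeg m \<le> N"
    "\<And>x. x \<in> U \<Longrightarrow> eval (u x) p = 0" for N p
    using that
  proof (induction N arbitrary: p rule: less_induct)
    case (less N)
    \<comment> \<open>On a curve that \<open>u\<close> maps to one with velocity the
      \<open>j\<close>-th unit vector, \<open>p\<close> stays zero, while the chain rule gives the
      \<open>j\<close>-th partial derivative as its derivative.\<close>
    have deriv: "partial_deriv j p = 0" if j: "j \<in> V" and "N \<noteq> 0" for j
    proof (rule less.IH)
      show "N - 1 < N" using that(2) by simp
      show "keys m \<subseteq> V \<and> mdeg m \<le> N - 1" if "m \<in> keys (partial_deriv j p)" for m
      proof -
        have "keys (m + single j 1) \<subseteq> V \<and> mdeg (m + single j 1) \<le> N"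
          using less.prems(1)[OF keys_partial_deriv[OF that]] .
        moreover have "keys m \<subseteq> keys (m + single j 1)" by (auto simp: in_keys_iff lookup_add)
        ultimately show ?thesis by (auto simp: mdeg_add)
      qed
      fix x assume x: "x \<in> U"
      obtain \<gamma> where \<gamma>: "isCont \<gamma> 0" "\<gamma> 0 = x"
        and d: "\<And>i. i \<in> V \<Longrightarrow> ((\<lambda>t. u (\<gamma> t) i) has_field_derivative (if i = j then 1 else 0)) (at 0)"
        using submersion[OF x j] by blast
      have "((\<lambda>t. eval (u (\<gamma> t)) p) has_field_derivative
          (\<Sum>i\<in>V. eval (u (\<gamma> 0)) (partial_deriv i p) * (if i = j then 1 else 0))) (at 0)"
        using less.prems(1) d by (intro eval_has_field_derivative assms(3)) auto
      then have D: "((\<lambda>t. eval (u (\<gamma> t)) p) has_field_derivative eval (u x) (partial_deriv j p)) (at 0)"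
        using j assms(3) \<gamma>(2) by (simp add: if_distrib sum.delta cong: if_cong)
      have "eventually (\<lambda>t. \<gamma> t \<in> U) (at 0)"
        using \<gamma> x \<open>open U\<close> unfolding isCont_def by (metis topological_tendstoD)
      then have "eventually (\<lambda>t. \<gamma> t \<in> U) (nhds 0)"
        using \<gamma>(2) x by (simp add: eventually_nhds_conv_at)
      then have "eventually (\<lambda>t. eval (u (\<gamma> t)) p = 0) (nhds 0)"
        by (rule eventually_mono) (rule less.prems(2))
      then have "((\<lambda>t. eval (u (\<gamma> t)) p) has_field_derivative 0) (at 0)"
        by (subst DERIV_cong_ev[OF refl _ refl, of _ "\<lambda>_. 0"]) auto
      with D show "eval (u x) (partial_deriv j p) = 0" by (rule DERIV_unique)
    qed
    \<comment> \<open>In characteristic zero a monomial containing the variable \<open>j\<close>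
      survives in the \<open>j\<close>-th partial derivative, so only the constant term can be
      left.\<close>
    have const: "m = 0" if m: "m \<in> keys p" for m
    proof (rule ccontr)
      assume "m \<noteq> 0"
      then obtain j where j: "j \<in> keys m" by (metis all_not_in_conv keys_eq_empty)
      then have "j \<in> V" "N \<noteq> 0"
        using less.prems(1)[OF m] \<open>m \<noteq> 0\<close> mdeg_eq_0_iff[of m] by auto
      then have "lookup (partial_deriv j p) (m - single j 1) = 0" using deriv by simp
      moreover have "m - single j 1 + single j 1 = m"
        using j by (intro mono_minus_plus_single) (simp add: in_keys_iff)
      ultimately have "complex_of_nat (lookup (m - single j 1) j + 1) * lookup p m = 0"
        unfolding lookup_partial_deriv by simp
      moreover have "complex_of_nat (n + 1) \<noteq> 0" for n by (metis Suc_eq_plus1 of_nat_neq_0)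
      ultimately show False using m by (metis in_keys_iff mult_eq_0_iff)
    qed
    then have p: "p = single 0 (lookup p 0)"
      by (intro poly_mapping_eqI) (metis in_keys_iff lookup_single_eq lookup_single_not_eq)
    obtain x where "x \<in> U" using assms(2) by blast
    then have "eval (u x) (single 0 (lookup p 0)) = 0" using less.prems(2) p by metis
    then show ?case using p by (metis eval_monom monom_eval_zero mult_1_right single_zero)
  qed
  from this[of p "\<Sum>m\<in>keys p. mdeg m"] show ?thesis
    using assms(5,6) by (simp add: member_le_sum)
qed

text \<open>The identity is a submersion: the curve through \<open>x\<close> for the index
  \<open>j\<close> changes only the \<open>j\<close>-th coordinate, at unit speed.\<close>

lemma eval_vanishing_on_open:
  fixes p :: "'v::finite mpoly"
  assumes "open U" "U \<noteq> {}" "\<And>a. a \<in> U \<Longrightarrow> eval (\<lambda>i. a $ i) p = 0"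
  shows "p = 0"
proof (rule vanishing_along_submersion[OF assms(1,2), of UNIV "\<lambda>a i. a $ i"])
  fix x :: "complex ^ 'v" and j :: 'v
  let ?\<gamma> = "\<lambda>t::complex. \<chi> i. x $ i + (if i = j then t else 0)"
  have "isCont ?\<gamma> 0"
    unfolding isCont_def
  proof (rule tendsto_vec_lambda)
    fix i show "((\<lambda>t. x $ i + (if i = j then t else 0)) \<longlongrightarrow> x $ i + (if i = j then 0 else 0)) (at 0)"
      by (cases "i = j") (auto intro!: tendsto_eq_intros)
  qed
  moreover have "?\<gamma> 0 = x" by (simp add: vec_eq_iff)
  moreover have "((\<lambda>t. ?\<gamma> t $ i) has_field_derivative (if i = j then 1 else 0)) (at 0)" for i
    by (auto intro!: derivative_eq_intros)
  ultimately show "\<exists>\<gamma>. isCont \<gamma> (0::complex) \<and> \<gamma> 0 = x \<and>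
      (\<forall>i\<in>UNIV. ((\<lambda>t. \<gamma> t $ i) has_field_derivative (if i = j then 1 else 0)) (at 0))"
    by blast
qed (use assms(3) in auto)

section \<open>Polynomial functions of bounded degree\<close>

text \<open>The bound is strict, so that terms of degree less than \<open>e\<close> are covered by
  \<open>poly_fun e\<close> also for \<open>e = 0\<close>, where only the zero function
  qualifies.\<close>

definition poly_fun :: "nat \<Rightarrow> (complex ^ 'n \<Rightarrow> complex) \<Rightarrow> bool" where
  "poly_fun D f \<longleftrightarrow>
     (\<exists>p :: 'n mpoly. (\<forall>m\<in>keys p. mdeg m < D) \<and> f = (\<lambda>a. eval (\<lambda>i. a $ i) p))"

lemma poly_funI: "(\<And>m. m \<in> keys p \<Longrightarrow> mdeg m < D) \<Longrightarrow> poly_fun D (\<lambda>a. eval (\<lambda>i. a $ i) p)"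
  unfolding poly_fun_def by blast

lemma poly_fun_mono: "poly_fun D f \<Longrightarrow> D \<le> D' \<Longrightarrow> poly_fun D' f"
  unfolding poly_fun_def using less_le_trans by blast

lemma poly_fun_zero: "poly_fun D (\<lambda>_. 0)"
  using poly_funI[of 0 D] by (simp add: eval_simps)

lemma poly_fun_const: "poly_fun (Suc D) (\<lambda>_. c)"
proof -
  have "poly_fun (Suc D) (\<lambda>a :: complex ^ 'a. eval (\<lambda>i. a $ i) (single 0 c))"
    by (rule poly_funI) (auto split: if_splits)
  then show ?thesis by (simp add: eval_simps)
qed

lemma poly_fun_coord: "poly_fun 2 (\<lambda>a. a $ i)"
  using poly_funI[of "single (single i 1) 1" 2] by (simp add: eval_simps)

lemma poly_fun_add: "poly_fun D f \<Longrightarrow> poly_fun D g \<Longrightarrow> poly_fun D (\<lambda>a. f a + g a)"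
  unfolding poly_fun_def
proof (elim exE conjE)
  fix p q assume *: "\<forall>m\<in>keys p. mdeg m < D" "\<forall>m\<in>keys q. mdeg m < D"
    "f = (\<lambda>a. eval (\<lambda>i. a $ i) p)" "g = (\<lambda>a. eval (\<lambda>i. a $ i) q)"
  then show "\<exists>p. (\<forall>m\<in>keys p. mdeg m < D) \<and> (\<lambda>a. f a + g a) = (\<lambda>a. eval (\<lambda>i. a $ i) p)"
    using keys_add[of p q] by (intro exI[of _ "p + q"]) (auto simp: eval_simps)
qed

text \<open>One factor has degree less than \<open>D\<close>, the other at most \<open>D'\<close>;
  this asymmetry keeps strict bounds from losing a degree.\<close>

lemma poly_fun_mult:
  "poly_fun D f \<Longrightarrow> poly_fun (Suc D') g \<Longrightarrow> poly_fun (D + D') (\<lambda>a. f a * g a)"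
  unfolding poly_fun_def
proof (elim exE conjE)
  fix p q assume *: "\<forall>m\<in>keys p. mdeg m < D" "\<forall>m\<in>keys q. mdeg m < Suc D'"
    "f = (\<lambda>a. eval (\<lambda>i. a $ i) p)" "g = (\<lambda>a. eval (\<lambda>i. a $ i) q)"
  have "mdeg m < D + D'" if m: "m \<in> keys (p * q)" for m
  proof -
    obtain k l where "m = k + l" "k \<in> keys p" "l \<in> keys q" using keys_mult[of p q] m by blast
    then show ?thesis using *(1,2) by (fastforce simp: mdeg_add)
  qed
  then show "\<exists>p. (\<forall>m\<in>keys p. mdeg m < D + D') \<and> (\<lambda>a. f a * g a) = (\<lambda>a. eval (\<lambda>i. a $ i) p)"
    using * by (intro exI[of _ "p * q"]) (auto simp: eval_simps)
qed

lemma poly_fun_cmult: "poly_fun D f \<Longrightarrow> poly_fun D (\<lambda>a. c * f a)"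
  using poly_fun_mult[OF _ poly_fun_const[of 0 c], of D f] by (simp add: mult.commute)

lemma poly_fun_diff: "poly_fun D f \<Longrightarrow> poly_fun D g \<Longrightarrow> poly_fun D (\<lambda>a. f a - g a)"
  using poly_fun_add[OF _ poly_fun_cmult[of D g "-1"], of f] by simp

lemma poly_fun_sum: "(\<And>x. x \<in> A \<Longrightarrow> poly_fun D (f x)) \<Longrightarrow> poly_fun D (\<lambda>a. \<Sum>x\<in>A. f x a)"
  by (induction A rule: infinite_finite_induct) (simp_all add: poly_fun_zero poly_fun_add)

lemma poly_fun_homogeneous: "homogeneous e p \<Longrightarrow> poly_fun (Suc e) (\<lambda>a. eval (\<lambda>i. a $ i) p)"
  by (rule poly_funI) (auto simp: homogeneous_def)

section \<open>Relations of bounded degree\<close>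

interpretation fun_space: vector_space "\<lambda>(c::complex) (f::'b \<Rightarrow> complex) x. c * f x"
  by unfold_locales (auto simp: algebra_simps)

(* As a rewrite rule this would be associativity from right to left under an abstraction. *)
declare fun_space.scale_scale [simp del]

text \<open>Coefficients with respect to \<open>W\<close> turn a dependence into a linear system
  with fewer equations than unknowns. Repeated members of the family count separately.\<close>

lemma family_in_small_span_dependent:
  fixes u :: "'s \<Rightarrow> 'b \<Rightarrow> complex"
  assumes "finite S" "finite W" "card W < card S" "\<And>s. s \<in> S \<Longrightarrow> u s \<in> fun_space.span W"
  shows "\<exists>x. (\<exists>s\<in>S. x s \<noteq> 0) \<and> (\<forall>y. (\<Sum>s\<in>S. x s * u s y) = 0)"
proof -
  have "\<forall>s\<in>S. \<exists>M. \<forall>y. u s y = (\<Sum>w\<in>W. M w * w y)"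
  proof
    fix s assume "s \<in> S"
    then obtain M where "u s = (\<Sum>w\<in>W. (\<lambda>y. M w * w y))"
      using assms(4) unfolding fun_space.span_finite[OF assms(2)] by blast
    moreover have "(\<Sum>w\<in>W. (\<lambda>y. M w * w y)) y = (\<Sum>w\<in>W. M w * w y)" for y
      by (induction W rule: infinite_finite_induct) simp_all
    ultimately show "\<exists>M. \<forall>y. u s y = (\<Sum>w\<in>W. M w * w y)" by auto
  qed
  then obtain M where M: "\<And>s y. s \<in> S \<Longrightarrow> u s y = (\<Sum>w\<in>W. M s w * w y)" by metis
  obtain x where x: "\<exists>s\<in>S. x s \<noteq> 0" "\<And>w. w \<in> W \<Longrightarrow> (\<Sum>s\<in>S. x s * M s w) = 0"
    using underdetermined_system[OF assms(2,1,3), of M] by blast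
  have "(\<Sum>s\<in>S. x s * u s y) = 0" for y
  proof -
    have "(\<Sum>s\<in>S. x s * u s y) = (\<Sum>s\<in>S. \<Sum>w\<in>W. x s * M s w * w y)"
      by (rule sum.cong) (simp_all add: M sum_distrib_left mult_ac)
    also have "\<dots> = (\<Sum>w\<in>W. (\<Sum>s\<in>S. x s * M s w) * w y)"
      by (subst sum.swap) (simp add: sum_distrib_right)
    finally show ?thesis by (simp add: x(2))
  qed
  with x(1) show ?thesis by blast
qed

text \<open>
  If the forms \<open>G i\<close> have no common zero besides the origin, then monomials of large degree can be
  rewritten by \<open>G i = h i + (\<Sum>\<alpha>. c \<alpha> * g i \<alpha>)\<close>. Hence the polynomial functions of degree at most \<open>D\<close>
  lie in the span of the products of boundedly many monomials with monomials of degree at most \<open>D\<close>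
  in the functions \<open>c \<alpha>\<close>. If there are fewer of these functions than variables, this is absurd for
  large \<open>D\<close> by counting dimensions.
\<close>

lemma no_bounded_degree_relation:
  fixes G :: "'n \<Rightarrow> 'n::finite mpoly" and c :: "'i \<Rightarrow> complex ^ 'n \<Rightarrow> complex"
  assumes hom: "\<And>i. homogeneous e (G i)"
    and nz: "\<And>a j. a j \<noteq> 0 \<Longrightarrow> \<exists>i. eval a (G i) \<noteq> 0"
    and I: "finite I" "card I < CARD('n)"
    and U: "open U" "U \<noteq> {}"
    and rel: "\<And>a i. a \<in> U \<Longrightarrow>
      eval (\<lambda>j. a $ j) (G i) = h i a + (\<Sum>\<alpha>\<in>I. c \<alpha> a * g i \<alpha> a)"
    and h: "\<And>i. poly_fun e (h i)" and g: "\<And>i \<alpha>. \<alpha> \<in> I \<Longrightarrow> poly_fun e (g i \<alpha>)"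
  shows False
proof -
  obtain B where eB: "e \<le> B" and
    B: "\<And>m. B \<le> mdeg m \<Longrightarrow> \<exists>q. single m 1 = (\<Sum>i\<in>UNIV. q i * G i) \<and>
       (\<forall>i. homogeneous (mdeg m - e) (q i))"
  proof (rule homogeneous_nullstellensatz[of e G])
    show "homogeneous e (G i)" for i by (rule hom)
    show "\<exists>i. eval a (G i) \<noteq> 0" if "a j \<noteq> 0" for a j by (rule nz[of a j]) (rule that)
  qed (rule that)
  \<comment> \<open>Functions are cut off outside \<open>U\<close>, so that relations valid on
    \<open>U\<close> become equations in the vector space of all functions.\<close>
  define R where "R f = (\<lambda>a. if a \<in> U then f a else (0::complex))" for f :: "complex ^ 'n \<Rightarrow> complex"
  \<comment> \<open>Indices of the spanning products: the exponent of each
    \<open>c \<alpha>\<close>, at most \<open>D\<close>, and a monomial in the coordinates of degree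
    at most \<open>B\<close>.\<close>
  define K where "K D = (\<Pi>\<^sub>E \<alpha>\<in>I. {..D}) \<times> {\<beta> :: 'n monomial. mdeg \<beta> \<le> B}" for D :: nat
  define w where "w z = R (\<lambda>a. (\<Prod>\<alpha>\<in>I. c \<alpha> a ^ fst z \<alpha>) * monom_eval (\<lambda>j. a $ j) (snd z))"
    for z :: "('i \<Rightarrow> nat) \<times> 'n monomial"
  define E where "E D = fun_space.span (w ` K D)" for D
  have finK: "finite (K D)" for D
    unfolding K_def by (intro finite_cartesian_product finite_PiE I(1) finite_mdeg_le) simp
  have E_mono: "f \<in> E D'" if "f \<in> E D" "D \<le> D'" for f D D'
  proof -
    have "(\<Pi>\<^sub>E \<alpha>\<in>I. {..D}) \<subseteq> (\<Pi>\<^sub>E \<alpha>\<in>I. {..D'})"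
      by (rule PiE_mono) (use that(2) in auto)
    then have "w ` K D \<subseteq> w ` K D'" unfolding K_def by blast
    then show ?thesis using that(1) fun_space.span_mono unfolding E_def by blast
  qed
  have E_add: "(\<lambda>a. f a + f' a) \<in> E D" if "f \<in> E D" "f' \<in> E D" for f f' D
    using fun_space.span_add[OF that[unfolded E_def]] by (simp add: E_def plus_fun_def)
  have E_cmult: "(\<lambda>a. x * f a) \<in> E D" if "f \<in> E D" for f x D
    using fun_space.span_scale[OF that[unfolded E_def]] by (simp add: E_def)
  have E_zero: "(\<lambda>a. 0) \<in> E D" for D
    using fun_space.span_zero by (simp add: E_def zero_fun_def)
  have E_sum: "(\<lambda>a. \<Sum>x\<in>A. f x a) \<in> E D" if "\<And>x. x \<in> A \<Longrightarrow> f x \<in> E D" for f D and A :: "'z set"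
    using that by (induction A rule: infinite_finite_induct) (simp_all add: E_zero E_add)
  have E_c: "(\<lambda>a. c \<alpha> a * f a) \<in> E (Suc D)" if f: "f \<in> E D" and \<alpha>: "\<alpha> \<in> I" for f D \<alpha>
    using f unfolding E_def
  proof (induction rule: fun_space.span_induct_alt)
    case base
    then show ?case using E_zero by (simp add: E_def zero_fun_def)
  next
    case (step x f f')
    then obtain z where z: "z \<in> K D" "f = w z" by blast
    let ?z = "((fst z)(\<alpha> := Suc (fst z \<alpha>)), snd z)"
    have zK: "?z \<in> K (Suc D)"
      using z(1) \<alpha> unfolding K_def by (fastforce simp: PiE_iff extensional_def)
    have "(\<Prod>\<beta>\<in>I. c \<beta> a ^ fst ?z \<beta>) = c \<alpha> a * (\<Prod>\<beta>\<in>I. c \<beta> a ^ fst z \<beta>)" for a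
    proof -
      have "(\<Prod>\<beta>\<in>I - {\<alpha>}. c \<beta> a ^ fst ?z \<beta>) = (\<Prod>\<beta>\<in>I - {\<alpha>}. c \<beta> a ^ fst z \<beta>)"
        by (rule prod.cong) auto
      then show ?thesis using I(1) \<alpha> by (simp add: prod.remove[of I \<alpha>])
    qed
    then have wz: "(\<lambda>a. c \<alpha> a * f a) = w ?z"
      unfolding z(2) w_def R_def by (intro ext) (simp add: mult.assoc)
    have "(\<lambda>a. c \<alpha> a * f a) \<in> E (Suc D)"
      unfolding E_def wz by (intro fun_space.span_base imageI zK)
    then have "(\<lambda>a. x * (c \<alpha> a * f a) + c \<alpha> a * f' a) \<in> E (Suc D)"
      using step by (intro E_add E_cmult) (simp_all only: E_def)
    moreover have "(\<lambda>a. x * (c \<alpha> a * f a) + c \<alpha> a * f' a)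
        = (\<lambda>a. c \<alpha> a * ((\<lambda>a. x * f a) + f') a)"
      by (intro ext) (simp add: plus_fun_def distrib_left mult.left_commute)
    ultimately show ?case by (simp only: E_def)
  qed
  have E_poly: "R f \<in> E D'" if f: "poly_fun D f"
    and mono: "\<And>m. mdeg m < D \<Longrightarrow> R (\<lambda>a. monom_eval (\<lambda>j. a $ j) m) \<in> E D'" for f D D'
  proof -
    obtain p :: "'n mpoly" where p: "\<And>m. m \<in> keys p \<Longrightarrow> mdeg m < D" "f = (\<lambda>a. eval (\<lambda>j. a $ j) p)"
      using f unfolding poly_fun_def by blast
    have "R f = (\<lambda>a. \<Sum>m\<in>keys p. lookup p m * R (\<lambda>a. monom_eval (\<lambda>j. a $ j) m) a)"
      unfolding p(2) R_def by (intro ext) (simp add: eval_superset[OF finite_keys subset_refl])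
    then show ?thesis by (simp only:) (intro E_sum E_cmult mono p(1))
  qed
  have mono: "R (\<lambda>a. monom_eval (\<lambda>j. a $ j) m) \<in> E (mdeg m)" for m
  proof (induction "mdeg m" arbitrary: m rule: less_induct)
    case less
    show ?case
    proof (cases "mdeg m \<le> B")
      case True
      have "w (\<lambda>\<alpha>\<in>I. 0, m) = R (\<lambda>a. monom_eval (\<lambda>j. a $ j) m)"
        unfolding w_def by simp
      moreover have "w (\<lambda>\<alpha>\<in>I. 0, m) \<in> E (mdeg m)"
        unfolding E_def by (intro fun_space.span_base imageI) (use True in \<open>auto simp: K_def\<close>)
      ultimately show ?thesis by simp
    next
      \<comment> \<open>Replacing each \<open>G i\<close> by means of \<open>rel\<close> leaves
        polynomial factors of degree less than \<open>mdeg m\<close>, to which the induction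
        applies; a factor \<open>c \<alpha>\<close> raises the exponent bound by one, from
        \<open>D\<close> to \<open>Suc D = mdeg m\<close>.\<close>
      case False
      then obtain q where q: "single m 1 = (\<Sum>i\<in>UNIV. q i * G i)"
        and qh: "\<And>i. homogeneous (mdeg m - e) (q i)" using B[of m] by auto
      let ?q = "\<lambda>i a. eval (\<lambda>j. a $ j) (q i)"
      obtain D where D: "mdeg m = Suc D" using False by (cases "mdeg m") auto
      have E_D: "R (\<lambda>a. monom_eval (\<lambda>j. a $ j) m') \<in> E D" if "mdeg m' < Suc D" for m'
        using E_mono[OF less(1)[of m']] that D by simp
      have ED: "R (\<lambda>a. \<Sum>i\<in>UNIV. ?q i a * f i a) \<in> E D" if "\<And>i. poly_fun e (f i)" for f
      proof (rule E_poly)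
        show "poly_fun (Suc D) (\<lambda>a. \<Sum>i\<in>UNIV. ?q i a * f i a)"
        proof (rule poly_fun_sum)
          fix i
          have "poly_fun (e + (mdeg m - e)) (\<lambda>a. f i a * ?q i a)"
            by (intro poly_fun_mult that poly_fun_homogeneous qh)
          then show "poly_fun (Suc D) (\<lambda>a. ?q i a * f i a)"
            using eB False D by (simp add: mult.commute)
        qed
      qed (rule E_D)
      have "R (\<lambda>a. monom_eval (\<lambda>j. a $ j) m) = (\<lambda>a. R (\<lambda>a. \<Sum>i\<in>UNIV. ?q i a * h i a) a
          + (\<Sum>\<alpha>\<in>I. c \<alpha> a * R (\<lambda>a. \<Sum>i\<in>UNIV. ?q i a * g i \<alpha> a) a))"
      proof
        fix a
        have "monom_eval (\<lambda>j. a $ j) m = (\<Sum>i\<in>UNIV. ?q i a * (h i a + (\<Sum>\<alpha>\<in>I. c \<alpha> a * g i \<alpha> a)))"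
          if a: "a \<in> U"
          using arg_cong[OF q, of "eval (\<lambda>j. a $ j)"] by (simp add: eval_simps rel[OF a])
        also have "\<dots> = (\<Sum>i\<in>UNIV. ?q i a * h i a)
            + (\<Sum>\<alpha>\<in>I. c \<alpha> a * (\<Sum>i\<in>UNIV. ?q i a * g i \<alpha> a))"
          by (simp add: distrib_left sum.distrib sum_distrib_left mult_ac)
            (rule sum.swap)
        finally show "R (\<lambda>a. monom_eval (\<lambda>j. a $ j) m) a = R (\<lambda>a. \<Sum>i\<in>UNIV. ?q i a * h i a) a
          + (\<Sum>\<alpha>\<in>I. c \<alpha> a * R (\<lambda>a. \<Sum>i\<in>UNIV. ?q i a * g i \<alpha> a) a)"
          by (simp add: R_def)
      qed
      then show ?thesis unfolding D using ED h g E_mono[OF ED[of h], of "Suc D"]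
        by (simp only:) (intro E_add E_sum E_c; simp)
    qed
  qed
  define q where "q = CARD('n)"
  define C where "C = card {\<beta> :: 'n monomial. mdeg \<beta> \<le> B}"
  \<comment> \<open>This makes the dimension bound \<open>(q * (D + 1)) ^ (q - 1) * C\<close> equal
    to \<open>(D + 1) ^ (q - 1) * D\<close>, which is less than the number
    \<open>(D + 1) ^ q\<close> of monomials with exponents at most \<open>D\<close>. Their degrees
    are at most \<open>q * D\<close>.\<close>
  define D where "D = C * q ^ (q - 1)"
  define F where "F = (\<Pi>\<^sub>E j\<in>(UNIV::'n set). {..D})"
  define mon where "mon f = (\<Sum>j\<in>UNIV. single j (f j))" for f :: "'n \<Rightarrow> nat"
  have lm: "lookup (mon f) j = f j" for f j
    by (simp add: mon_def lookup_sum lookup_single when_def)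
  have inj: "mon f = mon f' \<longleftrightarrow> f = f'" for f f' using lm by (metis ext)
  have in_E: "R (\<lambda>a. monom_eval (\<lambda>j. a $ j) (mon f)) \<in> E (q * D)" if "f \<in> F" for f
  proof (rule E_mono[OF mono])
    have "mdeg (mon f) \<le> (\<Sum>j\<in>(UNIV::'n set). D)"
      unfolding mdeg_UNIV lm by (rule sum_mono) (use that in \<open>auto simp: F_def\<close>)
    then show "mdeg (mon f) \<le> q * D" by (simp add: q_def)
  qed
  have q: "q = Suc (q - 1)" by (simp add: q_def)
  have cF: "card F = (D + 1) ^ q" by (simp add: F_def card_PiE q_def)
  have "card (w ` K (q * D)) \<le> card (K (q * D))" by (rule card_image_le[OF finK])
  also have "\<dots> = (q * D + 1) ^ card I * C"
    using I(1) by (simp add: K_def card_cartesian_product card_PiE C_def)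
  also have "\<dots> \<le> (q * D + 1) ^ (q - 1) * C"
    using I(2) by (intro mult_right_mono power_increasing) (auto simp: q_def)
  also have "\<dots> \<le> (q * (D + 1)) ^ (q - 1) * C"
    by (intro mult_right_mono power_mono) (auto simp: q_def Suc_leI)
  also have "\<dots> = (D + 1) ^ (q - 1) * (C * q ^ (q - 1))"
    by (simp only: power_mult_distrib mult_ac)
  also have "\<dots> = (D + 1) ^ (q - 1) * D" by (simp only: D_def)
  also have "\<dots> < (D + 1) ^ (q - 1) * (D + 1)" by simp
  also have "\<dots> = card F" unfolding cF using power_Suc2[of "D + 1" "q - 1"] q by metis
  finally have card: "card (w ` K (q * D)) < card F" .
  have finF: "finite F" unfolding F_def by (intro finite_PiE) auto
  obtain x where x: "\<exists>f\<in>F. x f \<noteq> 0"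
    and x0: "\<And>a. (\<Sum>f\<in>F. x f * R (\<lambda>a. monom_eval (\<lambda>j. a $ j) (mon f)) a) = 0"
    using family_in_small_span_dependent[OF finF finite_imageI[OF finK] card, of
        "\<lambda>f. R (\<lambda>a. monom_eval (\<lambda>j. a $ j) (mon f))"] in_E unfolding E_def by blast
  let ?p = "\<Sum>f\<in>F. single (mon f) (x f)"
  have "?p = 0"
  proof (rule eval_vanishing_on_open[OF U])
    fix a assume "a \<in> U"
    then show "eval (\<lambda>j. a $ j) ?p = 0" using x0[of a] by (simp add: eval_simps R_def)
  qed
  moreover have "lookup ?p (mon f) = x f" if "f \<in> F" for f
    using that finF by (simp add: lookup_sum lookup_single when_def inj)
  ultimately show False using x by auto
qed

section \<open>Pullbacks along linear maps\<close>

lemma mpoly_eval_eqI: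
  fixes p q :: "'v::finite mpoly"
  assumes "\<And>a :: complex ^ 'v. eval (\<lambda>i. a $ i) p = eval (\<lambda>i. a $ i) q"
  shows "p = q"
proof -
  have "p - q = 0"
    by (rule eval_vanishing_on_open[of UNIV]) (simp_all add: eval_simps assms)
  then show ?thesis by simp
qed

definition linear_form :: "('w \<Rightarrow> complex) \<Rightarrow> 'w::finite mpoly" where
  "linear_form b = (\<Sum>j\<in>UNIV. single (single j 1) (b j))"

lemma pullback_alt: "pullback A f = subst (\<lambda>i. linear_form (\<lambda>j. A $ i $ j)) f"
  by (simp add: pullback_def linear_form_def)

lemma lookup_linear_form:
  "lookup (linear_form b) m = (\<Sum>j\<in>UNIV. b j * lookup (single (single j 1) 1) m)"
  by (simp add: linear_form_def lookup_sum lookup_single when_def if_distrib cong: if_cong)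

lemma eval_linear_form: "eval a (linear_form b) = (\<Sum>j\<in>UNIV. b j * a j)"
  by (simp add: linear_form_def eval_simps)

lemma homogeneous_linear_form: "homogeneous 1 (linear_form b)"
  unfolding linear_form_def by (intro homogeneous_sum homogeneous_single) simp

lemma eval_subst: "eval a (subst \<sigma> p) = eval (\<lambda>i. eval a (\<sigma> i)) p"
proof (induction p rule: mpoly_induct)
  case (single m c)
  have "eval a (monom_eval \<sigma> m) = monom_eval (\<lambda>i. eval a (\<sigma> i)) m"
    by (rule monom_eval_hom) (simp_all add: eval_simps)
  then show ?case by (simp add: eval_simps subst_simps)
qed (simp_all add: eval_simps subst_simps)

lemma eval_pullback: "eval (\<lambda>j. y $ j) (pullback A f) = eval (\<lambda>i. (A *v y) $ i) f"
  by (simp add: pullback_alt eval_subst eval_linear_form matrix_vector_mult_def)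

lemma pullback_pullback: "pullback B (pullback A f) = pullback (A ** B) f"
  by (rule mpoly_eval_eqI) (simp add: eval_pullback matrix_vector_mul_assoc)

lemma pullback_smult: "pullback A (single 0 c * f) = single 0 c * pullback A f"
  by (rule mpoly_eval_eqI) (simp add: eval_pullback eval_simps)

lemma pullback_expand:
  "pullback A f = (\<Sum>m\<in>keys f. single 0 (lookup f m) * monom_eval (\<lambda>i. linear_form (\<lambda>j. A $ i $ j)) m)"
  unfolding pullback_alt subst_def
  by (simp add: const_hom.mpoly_hom_superset[OF finite_keys subset_refl])

lemma homogeneous_pullback:
  assumes "homogeneous d f" shows "homogeneous d (pullback A f)"
  unfolding pullback_expand
proof (intro homogeneous_sum homogeneous_smult)
  fix m assume "m \<in> keys f"
  then have "mdeg m = d" using assms by (simp add: homogeneous_def)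
  then show "homogeneous d (monom_eval (\<lambda>i. linear_form (\<lambda>j. A $ i $ j)) m)"
    using homogeneous_monom_eval[of "\<lambda>i. linear_form (\<lambda>j. A $ i $ j)" m]
    by (simp add: homogeneous_linear_form[unfolded One_nat_def])
qed

section \<open>Coefficients of powers of linear forms\<close>

lemma lookup_single_mult:
  "lookup (single k c * p) m = (if \<exists>l. m = k + l then c * lookup p (m - k) else 0)"
  for p :: "'v mpoly"
proof (induction p rule: mpoly_induct)
  case (single l a)
  show ?case
  proof (cases "\<exists>l. m = k + l")
    case True
    then obtain l' where "m = k + l'" by blast
    then show ?thesis by (simp add: mult_single lookup_single when_def)
  next
    case False
    then show ?thesis by (auto simp: mult_single lookup_single when_def)
  qed
qed (simp_all add: distrib_left lookup_add)

lemma lookup_linear_form_mult: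
  "lookup (linear_form b * p) m = (\<Sum>j\<in>keys m. b j * lookup p (m - single j 1))"
proof -
  have "(\<exists>l. m = single j 1 + l) \<longleftrightarrow> j \<in> keys m" for j
  proof
    assume "j \<in> keys m"
    then have "m = single j 1 + (m - single j 1)"
      using mono_minus_plus_single[of m j] by (simp add: in_keys_iff add.commute)
    then show "\<exists>l. m = single j 1 + l" by blast
  qed (auto simp: in_keys_iff lookup_add)
  then have "lookup (linear_form b * p) m
      = (\<Sum>j\<in>UNIV. if j \<in> keys m then b j * lookup p (m - single j 1) else 0)"
    by (simp add: linear_form_def sum_distrib_right lookup_sum lookup_single_mult
        del: One_nat_def)
  then show ?thesis by (simp add: sum.If_cases)
qed

text \<open>In degree \<open>e\<close> the \<open>M m\<close> are the multinomial coefficients,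
  built by the recursion of Pascal's triangle. They are positive and do not depend on
  \<open>b\<close>, which makes a pairing with the power a polynomial in \<open>b\<close>.\<close>

lemma lookup_linear_form_power:
  "\<exists>M :: 'w::finite monomial \<Rightarrow> nat. \<forall>m. (mdeg m = e \<longrightarrow> M m > 0) \<and>
     (\<forall>b. lookup (linear_form b ^ e) m = of_nat (M m) * monom_eval b m)"
proof (induction e)
  case 0
  show ?case
    by (rule exI[of _ "\<lambda>m. if m = 0 then 1 else 0"])
      (auto simp: lookup_one when_def mdeg_eq_0_iff)
next
  case (Suc e)
  obtain M :: "'w monomial \<Rightarrow> nat" where "\<forall>m. (mdeg m = e \<longrightarrow> M m > 0) \<and>
      (\<forall>b. lookup (linear_form b ^ e) m = of_nat (M m) * monom_eval b m)"
    using Suc by blast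
  then have M: "\<And>m. mdeg m = e \<Longrightarrow> M m > 0"
    "\<And>m b. lookup (linear_form b ^ e) m = of_nat (M m) * monom_eval b m" by auto
  let ?M = "\<lambda>m. \<Sum>j\<in>keys m. M (m - single j 1)"
  have minus: "m - single j 1 + single j 1 = m" if "j \<in> keys m" for m :: "'w monomial" and j
    using that by (intro mono_minus_plus_single) (simp add: in_keys_iff)
  have "?M m > 0" if m: "mdeg m = Suc e" for m
  proof -
    have "keys m \<noteq> {}" using m by auto
    moreover have "M (m - single j 1) > 0" if "j \<in> keys m" for j
      using arg_cong[OF minus[OF that], of mdeg] m by (intro M(1)) (simp add: mdeg_add)
    ultimately show ?thesis by (intro sum_pos) auto
  qed
  moreover have "lookup (linear_form b ^ Suc e) m = of_nat (?M m) * monom_eval b m"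
    for b and m :: "'w monomial"
  proof -
    have "lookup (linear_form b ^ Suc e) m
        = (\<Sum>j\<in>keys m. b j * lookup (linear_form b ^ e) (m - single j 1))"
      by (simp only: power_Suc lookup_linear_form_mult)
    also have "\<dots> = (\<Sum>j\<in>keys m. b j * (of_nat (M (m - single j 1)) * monom_eval b (m - single j 1)))"
      by (rule sum.cong[OF refl]) (simp only: M(2))
    also have "\<dots> = (\<Sum>j\<in>keys m. of_nat (M (m - single j 1)) * monom_eval b m)"
    proof (rule sum.cong[OF refl])
      fix j assume "j \<in> keys m"
      then have "monom_eval b m = monom_eval b (m - single j 1) * b j"
        using monom_eval_add[of b "m - single j 1" "single j 1"] minus by simp
      then show "b j * (of_nat (M (m - single j 1)) * monom_eval b (m - single j 1))
          = of_nat (M (m - single j 1)) * monom_eval b m"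
        by (simp add: mult_ac)
    qed
    finally show ?thesis by (simp add: sum_distrib_right)
  qed
  ultimately show ?case by (intro exI[of _ ?M] allI conjI impI)
qed

text \<open>In dual form: the powers of linear forms span all forms.\<close>

lemma functional_nonzero_on_linear_form_power:
  fixes \<phi> :: "'k::finite monomial \<Rightarrow> complex"
  assumes "mdeg m0 = e" "\<phi> m0 \<noteq> 0"
  shows "\<exists>b. (\<Sum>m | mdeg m = e. \<phi> m * lookup (linear_form b ^ e) m) \<noteq> 0"
proof (rule ccontr)
  assume no: "\<nexists>b. (\<Sum>m | mdeg m = e. \<phi> m * lookup (linear_form b ^ e) m) \<noteq> 0"
  obtain M :: "'k monomial \<Rightarrow> nat" where "\<forall>m. (mdeg m = e \<longrightarrow> M m > 0) \<and>
      (\<forall>b. lookup (linear_form b ^ e) m = of_nat (M m) * monom_eval b m)"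
    using lookup_linear_form_power[of e] by blast
  then have M: "\<And>m. mdeg m = e \<Longrightarrow> M m > 0"
    "\<And>m b. lookup (linear_form b ^ e) m = of_nat (M m) * monom_eval b m" by auto
  \<comment> \<open>Its value at \<open>b\<close> is the pairing of \<open>\<phi>\<close> with the
    power of the linear form of \<open>b\<close>, so it would vanish everywhere.\<close>
  let ?p = "\<Sum>m | mdeg m = e. single m (\<phi> m * of_nat (M m))"
  have "?p = 0"
    by (rule mpoly_eval_eqI) (use no in \<open>simp add: eval_simps M(2) mult.assoc\<close>)
  moreover have "lookup ?p m0 = \<phi> m0 * of_nat (M m0)"
    using assms(1) by (simp add: lookup_sum lookup_single when_def finite_mdeg_eq)
  ultimately show False using assms M(1)[of m0] by simp
qed

section \<open>Dependence of the pullback on the linear map\<close>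

text \<open>The coefficients are polynomial in the entries of \<open>A\<close>; continuity passes
  from linear forms to products by convolution.\<close>

lemma continuous_lookup_pullback:
  "continuous_on UNIV (\<lambda>A :: complex ^ 'w::finite ^ 'v::finite. lookup (pullback A f) m)"
proof -
  let ?C = "\<lambda>X :: complex ^ 'w ^ 'v \<Rightarrow> 'w mpoly. \<forall>m. continuous_on UNIV (\<lambda>A. lookup (X A) m)"
  have mult: "?C (\<lambda>A. X A * Y A)" if "?C X" "?C Y" for X Y
    unfolding lookup_mult_decompositions using that by (auto intro!: continuous_intros)
  have one: "?C (\<lambda>A. 1)" by auto
  have pow: "?C (\<lambda>A. X A ^ n)" if "?C X" for X n
    by (induction n) (use one mult[OF that] in auto)
  have prd: "?C (\<lambda>A. \<Prod>i\<in>S. X i A)" if "\<And>i. ?C (X i)" for X and S :: "'v set"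
  proof (induction S rule: infinite_finite_induct)
    case (insert i S)
    then show ?case using mult[OF that[of i], of "\<lambda>A. \<Prod>i\<in>S. X i A"] by simp
  qed (use one in auto)
  have lin: "?C (\<lambda>A. linear_form (\<lambda>j. A $ i $ j))" for i
    unfolding lookup_linear_form by (auto intro!: continuous_intros)
  have "?C (\<lambda>A. monom_eval (\<lambda>i. linear_form (\<lambda>j. A $ i $ j)) m)" for m
    unfolding monom_eval_def by (intro prd pow lin)
  then show ?thesis unfolding pullback_expand lookup_sum lookup_smult
    by (auto intro!: continuous_intros)
qed

text \<open>The differential of composing \<open>f\<close> with a linear map, in direction
  \<open>B\<close>: the product rule for each monomial of \<open>f\<close>, taken
  coefficientwise.\<close>

lemma lookup_pullback_has_field_derivative:
  fixes A B :: "complex ^ 'w::finite ^ 'v::finite"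
  shows "((\<lambda>t. lookup (pullback (\<chi> i j. A $ i $ j + t * B $ i $ j) f) m) has_field_derivative
    lookup (\<Sum>i\<in>UNIV. linear_form (\<lambda>j. B $ i $ j) * pullback A (partial_deriv i f)) m) (at 0)"
proof -
  define D where "D X X' \<longleftrightarrow> (\<forall>m. ((\<lambda>t. lookup (X t) m) has_field_derivative lookup X' m) (at 0))"
    for X :: "complex \<Rightarrow> 'w mpoly" and X'
  have const: "D (\<lambda>t. p) 0" for p by (simp add: D_def)
  have add: "D (\<lambda>t. X t + Y t) (X' + Y')" if "D X X'" "D Y Y'" for X X' Y Y'
    using that unfolding D_def lookup_add by (auto intro: DERIV_add)
  have mult: "D (\<lambda>t. X t * Y t) (X' * Y 0 + X 0 * Y')" if X: "D X X'" and Y: "D Y Y'" for X X' Y Y'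
    unfolding D_def
  proof
    fix m
    have "((\<lambda>t. \<Sum>z | fst z + snd z = m. lookup (X t) (fst z) * lookup (Y t) (snd z)) has_field_derivative
        (\<Sum>z | fst z + snd z = m. lookup (X 0) (fst z) * lookup Y' (snd z)
          + lookup X' (fst z) * lookup (Y 0) (snd z))) (at 0)"
      using X Y unfolding D_def by (intro DERIV_sum DERIV_mult') blast+
    then show "((\<lambda>t. lookup (X t * Y t) m) has_field_derivative lookup (X' * Y 0 + X 0 * Y') m) (at 0)"
      by (simp add: lookup_mult_decompositions lookup_add sum.distrib add.commute)
  qed
  have sum: "D (\<lambda>t. \<Sum>x\<in>S. X x t) (\<Sum>x\<in>S. X' x)" if "\<And>x. x \<in> S \<Longrightarrow> D (X x) (X' x)" for X X' and S :: "'z set"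
    using that by (induction S rule: infinite_finite_induct) (simp_all add: const add)
  define \<sigma> where "\<sigma> t i = linear_form (\<lambda>j. A $ i $ j + t * B $ i $ j)" for t i
  define \<beta> where "\<beta> i = linear_form (\<lambda>j. B $ i $ j)" for i
  have lin: "D (\<lambda>t. \<sigma> t i) (\<beta> i)" for i
    unfolding D_def \<sigma>_def \<beta>_def lookup_linear_form
    by (intro allI DERIV_sum) (auto intro!: derivative_eq_intros)
  \<comment> \<open>The expected derivative of the monomial \<open>m\<close>. Under addition of
    exponents it obeys the Leibniz rule \<open>M'_add\<close>, matching the rule \<open>mult\<close>
    for \<open>D\<close>.\<close>
  define M' where "M' m = (\<Sum>i\<in>UNIV. of_nat (lookup m i) * \<beta> i * monom_eval (\<sigma> 0) (m - single i 1))"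
    for m
  have shift: "of_nat (lookup m i) * monom_eval (\<sigma> 0) (m + n - single i 1)
      = of_nat (lookup m i) * (monom_eval (\<sigma> 0) (m - single i 1) * monom_eval (\<sigma> 0) n)" for m n i
  proof (cases "lookup m i = 0")
    case False
    then have "m + n - single i 1 = m - single i 1 + n"
      by (intro poly_mapping_eqI) (auto simp: lookup_add lookup_minus lookup_single when_def)
    then show ?thesis by (simp only: monom_eval_add)
  qed simp
  have M'_add: "M' (m + n) = M' m * monom_eval (\<sigma> 0) n + monom_eval (\<sigma> 0) m * M' n" for m n
  proof -
    have "M' (m + n) = (\<Sum>i\<in>UNIV. \<beta> i * (of_nat (lookup m i) * monom_eval (\<sigma> 0) (m + n - single i 1))
        + \<beta> i * (of_nat (lookup n i) * monom_eval (\<sigma> 0) (n + m - single i 1)))"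
      unfolding M'_def by (intro sum.cong) (simp_all add: lookup_add distrib_right distrib_left add.commute mult.left_commute mult.assoc)
    also have "\<dots> = M' m * monom_eval (\<sigma> 0) n + monom_eval (\<sigma> 0) m * M' n"
      unfolding shift M'_def sum.distrib sum_distrib_left sum_distrib_right
      by (simp only: mult.assoc mult.left_commute mult.commute)
    finally show ?thesis .
  qed
  have mono: "D (\<lambda>t. monom_eval (\<sigma> t) m) (M' m)" for m
  \<comment> \<open>Exponent vectors are finitely supported maps as well, so the induction splits
    \<open>m\<close> into powers of single variables.\<close>
  proof (induction m rule: mpoly_induct)
    case zero
    then show ?case by (simp add: M'_def const)
  next
    case (single i n)
    show ?case
    proof (induction n)
      case 0
      then show ?case by (simp add: M'_def const)
    next
      case (Suc n)
      have "M' (single i 1) = (\<Sum>j\<in>UNIV. if j = i then \<beta> i else 0)"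
        unfolding M'_def by (rule sum.cong) (auto simp: lookup_single when_def)
      then have "D (\<lambda>t. monom_eval (\<sigma> t) (single i 1)) (M' (single i 1))"
        using lin[of i] by (simp add: sum.delta)
      from mult[OF Suc this]
      have "D (\<lambda>t. monom_eval (\<sigma> t) (single i n + single i 1)) (M' (single i n + single i 1))"
        by (simp only: monom_eval_add M'_add)
      then show ?case by (simp flip: single_add)
    qed
  next
    case (add m n)
    then show ?case using mult by (simp only: monom_eval_add M'_add)
  qed
  have smult: "D (\<lambda>t. single 0 c * X t) (single 0 c * X')" if "D X X'" for c X X'
    using mult[OF const[of "single 0 c"] that] by simp
  have "D (\<lambda>t. \<Sum>m\<in>keys f. single 0 (lookup f m) * monom_eval (\<sigma> t) m)
      (\<Sum>m\<in>keys f. single 0 (lookup f m) * M' m)"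
    by (intro sum smult mono)
  moreover have "(\<Sum>m\<in>keys f. single 0 (lookup f m) * monom_eval (\<sigma> t) m)
      = pullback (\<chi> i j. A $ i $ j + t * B $ i $ j) f" for t
    by (simp add: pullback_expand \<sigma>_def[abs_def])
  moreover have "(\<Sum>m\<in>keys f. single 0 (lookup f m) * M' m)
      = (\<Sum>i\<in>UNIV. \<beta> i * pullback A (partial_deriv i f))"
  proof -
    have \<sigma>0: "\<sigma> 0 = (\<lambda>i. linear_form (\<lambda>j. A $ i $ j))" by (simp add: \<sigma>_def[abs_def])
    have "pullback A (partial_deriv i f) = (\<Sum>m\<in>keys f. single 0 (lookup f m) *
        (of_nat (lookup m i) * monom_eval (\<sigma> 0) (m - single i 1)))" for i
      unfolding pullback_alt \<sigma>0[symmetric] partial_deriv_def subst_simps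
      by (rule sum.cong[OF refl]) (simp add: mult_single mult.assoc[symmetric] mult.commute flip: single_of_nat)
    then show ?thesis
      unfolding M'_def sum_distrib_left
      by (subst sum.swap) (simp only: sum_distrib_left mult.assoc mult.left_commute)
  qed
  ultimately have "D (\<lambda>t. pullback (\<chi> i j. A $ i $ j + t * B $ i $ j) f)
      (\<Sum>i\<in>UNIV. \<beta> i * pullback A (partial_deriv i f))" by simp
  then show ?thesis unfolding D_def \<beta>_def by blast
qed

text \<open>Moving \<open>A\<close> by a map of rank one, the term of top degree is read off from \<open>f (a \<cdot> \<ell>) = f a \<cdot> \<ell>\<^sup>e\<close>.\<close>

lemma lookup_pullback_rank_one:
  fixes A :: "complex ^ 'w::finite ^ 'v::finite"
  assumes "homogeneous e f"
  shows "poly_fun e (\<lambda>a. lookup (pullback (\<chi> i j. A $ i $ j + a $ i * b j) f) m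
    - eval (\<lambda>i. a $ i) f * lookup (linear_form b ^ e) m)"
proof -
  define L where "L = linear_form b"
  \<comment> \<open>\<open>Q j P q\<close> says that, as a polynomial in \<open>a\<close>,
    \<open>P a\<close> is \<open>q a * L ^ j\<close> up to terms of degree less than
    \<open>j\<close>, where \<open>q\<close> has degree at most \<open>j\<close>. This is stable
    under products.\<close>
  define Q where "Q j P q \<longleftrightarrow> poly_fun (Suc j) q \<and>
      (\<forall>m. poly_fun j (\<lambda>a. lookup (P a - single 0 (q a) * L ^ j) m))"
    for j and P :: "complex ^ 'v \<Rightarrow> 'w mpoly" and q
  have lm: "poly_fun (j + j') (\<lambda>a. lookup (X a * Y a) m)"
    if "\<And>m. poly_fun j (\<lambda>a. lookup (X a) m)" "\<And>m. poly_fun (Suc j') (\<lambda>a. lookup (Y a) m)"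
    for j j' X Y and m :: "'w monomial"
    unfolding lookup_mult_decompositions by (intro poly_fun_sum poly_fun_mult that)
  have mult: "Q (j + j') (\<lambda>a. P a * P' a) (\<lambda>a. q a * q' a)" if Q: "Q j P q" and Q': "Q j' P' q'"
    for j j' P P' q q'
  proof -
    have q: "poly_fun (Suc j) q" and q': "poly_fun (Suc j') q'" using Q Q' by (auto simp: Q_def)
    have c: "poly_fun (Suc j) (\<lambda>a. lookup (single 0 (q a) * L ^ j) m)" for m
      using poly_fun_mult[OF q poly_fun_const[of 0]] by simp
    have c': "poly_fun (Suc j') (\<lambda>a. lookup (P' a) m)" for m
    proof -
      have "poly_fun (Suc j') (\<lambda>a. lookup (P' a - single 0 (q' a) * L ^ j') m + q' a * lookup (L ^ j') m)"
        using Q' poly_fun_mult[OF q' poly_fun_const[of 0]]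
        by (intro poly_fun_add) (auto simp: Q_def intro: poly_fun_mono)
      then show ?thesis by (simp add: lookup_minus)
    qed
    \<comment> \<open>Each summand is the error of one factor, times the other factor or its leading
      part; together they telescope to the error of the product.\<close>
    have "poly_fun (j + j') (\<lambda>a. lookup ((P a - single 0 (q a) * L ^ j) * P' a) m
        + lookup ((P' a - single 0 (q' a) * L ^ j') * (single 0 (q a) * L ^ j)) m)" for m
      using lm[of j "\<lambda>a. P a - single 0 (q a) * L ^ j" j' P' m]
        lm[of j' "\<lambda>a. P' a - single 0 (q' a) * L ^ j'" j "\<lambda>a. single 0 (q a) * L ^ j" m]
        Q Q' c c' by (intro poly_fun_add) (auto simp: Q_def add.commute)
    moreover have "(P a - single 0 (q a) * L ^ j) * P' a
        + (P' a - single 0 (q' a) * L ^ j') * (single 0 (q a) * L ^ j)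
        = P a * P' a - single 0 (q a * q' a) * L ^ (j + j')" for a
    proof -
      have "single 0 (q a * q' a) = single 0 (q a) * (single 0 (q' a) :: 'w mpoly)"
        by (simp add: mult_single)
      then show ?thesis
        by (simp only: power_add left_diff_distrib) (simp add: mult_ac)
    qed
    ultimately have "poly_fun (j + j') (\<lambda>a. lookup (P a * P' a - single 0 (q a * q' a) * L ^ (j + j')) m)" for m
      by (simp only: lookup_add[symmetric])
    moreover have "poly_fun (Suc (j + j')) (\<lambda>a. q a * q' a)"
      using poly_fun_mult[OF q q'] by simp
    ultimately show ?thesis by (simp add: Q_def)
  qed
  have one: "Q 0 (\<lambda>a. 1) (\<lambda>a. 1)"
    by (simp add: Q_def poly_fun_zero poly_fun_const[of 0, simplified])
  have pow: "Q (n * j) (\<lambda>a. P a ^ n) (\<lambda>a. q a ^ n)" if "Q j P q" for n j P q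
    by (induction n) (use one mult[OF that] in auto)
  have prd: "Q (\<Sum>i\<in>S. j i) (\<lambda>a. \<Prod>i\<in>S. P i a) (\<lambda>a. \<Prod>i\<in>S. q i a)"
    if "\<And>i. Q (j i) (P i) (q i)" for j P q and S :: "'v set"
  proof (induction S rule: infinite_finite_induct)
    case (insert i S)
    then show ?case using mult[OF that[of i] insert.IH] by simp
  qed (use one in auto)
  define \<sigma> where "\<sigma> a i = linear_form (\<lambda>j. A $ i $ j + a $ i * b j)" for a :: "complex ^ 'v" and i
  have lin: "Q 1 (\<lambda>a. \<sigma> a i) (\<lambda>a. a $ i)" for i
  proof -
    have "\<sigma> a i - single 0 (a $ i) * L = linear_form (\<lambda>j. A $ i $ j)" for a
      by (rule mpoly_eval_eqI)
        (simp add: \<sigma>_def L_def eval_simps eval_linear_form distrib_right sum.distrib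
          sum_distrib_left mult.assoc)
    then show ?thesis
      using poly_fun_coord[of i] by (simp add: Q_def numeral_2_eq_2 poly_fun_const)
  qed
  have mono: "Q (mdeg m) (\<lambda>a. monom_eval (\<sigma> a) m) (\<lambda>a. monom_eval (\<lambda>i. a $ i) m)" for m
    unfolding monom_eval_def mdeg_def using prd[OF pow[OF lin], of "lookup m" "keys m"] by simp
  have "poly_fun e (\<lambda>a. \<Sum>n\<in>keys f. lookup f n *
      lookup (monom_eval (\<sigma> a) n - single 0 (monom_eval (\<lambda>i. a $ i) n) * L ^ e) m)"
  proof (intro poly_fun_sum poly_fun_cmult)
    fix n assume "n \<in> keys f"
    then have "mdeg n = e" using assms by (simp add: homogeneous_def)
    then show "poly_fun e (\<lambda>a. lookup (monom_eval (\<sigma> a) n - single 0 (monom_eval (\<lambda>i. a $ i) n) * L ^ e) m)"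
      using mono[of n] by (auto simp: Q_def)
  qed
  moreover have "lookup (pullback (\<chi> i j. A $ i $ j + a $ i * b j) f) m
      - eval (\<lambda>i. a $ i) f * lookup (L ^ e) m
      = (\<Sum>n\<in>keys f. lookup f n *
          lookup (monom_eval (\<sigma> a) n - single 0 (monom_eval (\<lambda>i. a $ i) n) * L ^ e) m)" for a
    by (simp add: pullback_expand \<sigma>_def[abs_def] lookup_sum lookup_minus right_diff_distrib sum_subtractf
        eval_superset[OF finite_keys subset_refl] sum_distrib_right mult.assoc)
  ultimately show ?thesis by (simp add: L_def)
qed

section \<open>Sections spanning all forms\<close>

text \<open>Independence of a family of vectors with coordinates in \<open>T\<close>, not of the set
  of its members: equal rows at two indices in \<open>S\<close> are dependent.\<close>

definition independent_rows :: "'t set \<Rightarrow> 's set \<Rightarrow> ('s \<Rightarrow> 't \<Rightarrow> complex) \<Rightarrow> bool" where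
  "independent_rows T S w \<longleftrightarrow>
     (\<forall>x. (\<forall>t\<in>T. (\<Sum>s\<in>S. x s * w s t) = 0) \<longrightarrow> (\<forall>s\<in>S. x s = 0))"

lemma independent_rowsD:
  "independent_rows T S w \<Longrightarrow> (\<And>t. t \<in> T \<Longrightarrow> (\<Sum>s\<in>S. x s * w s t) = 0) \<Longrightarrow> s \<in> S \<Longrightarrow> x s = 0"
  unfolding independent_rows_def by blast

lemma in_span_of_independent_rows:
  assumes "finite S" "independent_rows T S w" "\<not> independent_rows T (insert r S) w" "r \<notin> S"
  shows "\<exists>x. \<forall>t\<in>T. w r t = (\<Sum>s\<in>S. x s * w s t)"
proof -
  obtain y where y: "\<And>t. t \<in> T \<Longrightarrow> y r * w r t + (\<Sum>s\<in>S. y s * w s t) = 0"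
    "\<exists>s\<in>insert r S. y s \<noteq> 0"
    using assms(1,3,4) unfolding independent_rows_def by auto
  have "y r \<noteq> 0"
  proof
    assume "y r = 0"
    then have "\<forall>s\<in>S. y s = 0" using y(1) independent_rowsD[OF assms(2), of y] by simp
    with \<open>y r = 0\<close> y(2) show False by simp
  qed
  then have "w r t = (\<Sum>s\<in>S. (- y s / y r) * w s t)" if "t \<in> T" for t
    using y(1)[OF that]
    by (simp add: sum_negf field_simps eq_neg_iff_add_eq_0 flip: sum_divide_distrib)
  then show ?thesis by (intro exI[of _ "\<lambda>s. - y s / y r"]) blast
qed

text \<open>The coordinate functionals of the independent rows extend linearly to all functions;
  their values on the unit vectors of \<open>T\<close> are the entries of
  \<open>\<psi>\<close>.\<close>

lemma dual_family_exists:
  assumes "finite S" "finite T" and ind: "independent_rows T S w"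
  shows "\<exists>\<psi>. \<forall>s\<in>S. \<forall>u\<in>S. (\<Sum>t\<in>T. \<psi> s t * w u t) = (if u = s then 1 else 0)"
proof -
  interpret pair: vector_space_pair "\<lambda>(c::complex) (f::'b \<Rightarrow> complex) x. c * f x" "(*) :: complex \<Rightarrow> _"
    by unfold_locales (auto simp: algebra_simps)
  \<comment> \<open>Extension by zero outside \<open>T\<close> makes each row a finite combination
    of unit vectors.\<close>
  define W where "W u = (\<lambda>t. if t \<in> T then w u t else 0)" for u
  have inj: "inj_on W S"
  proof (rule inj_onI, rule ccontr)
    fix s u assume su: "s \<in> S" "u \<in> S" "W s = W u" "s \<noteq> u"
    have "(\<Sum>r\<in>S. (if r = s then 1 else if r = u then - 1 else 0) * w r t) = 0" if "t \<in> T" for t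
    proof -
      have "w s t = w u t" using fun_cong[OF su(3), of t] that by (simp add: W_def)
      moreover have "(\<Sum>r\<in>S. (if r = s then 1 else if r = u then - 1 else 0) * w r t)
          = (\<Sum>r\<in>S. (if r = s then w r t else 0) - (if r = u then w r t else 0))"
        by (rule sum.cong) (use su(4) in auto)
      ultimately show ?thesis using su assms(1) by (simp add: sum_subtractf)
    qed
    from independent_rowsD[OF ind this su(1)] show False by simp
  qed
  have "fun_space.independent (W ` S)"
  proof
    assume "fun_space.dependent (W ` S)"
    then obtain x where x: "\<exists>v\<in>W ` S. x v \<noteq> 0" "(\<Sum>v\<in>W ` S. (\<lambda>t. x v * v t)) = 0"
      unfolding fun_space.dependent_finite[OF finite_imageI[OF assms(1)]] by blast
    have sum_app: "(\<Sum>v\<in>A. (\<lambda>t. x v * v t)) t = (\<Sum>v\<in>A. x v * v t)" for A :: "('b \<Rightarrow> complex) set" and t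
      by (induction A rule: infinite_finite_induct) simp_all
    have "(\<Sum>s\<in>S. x (W s) * w s t) = 0" if "t \<in> T" for t
    proof -
      have "(\<Sum>v\<in>W ` S. x v * v t) = 0"
        using sum_app[of "W ` S" t] fun_cong[OF x(2), of t] by simp
      then have "(\<Sum>s\<in>S. x (W s) * W s t) = 0" by (simp only: sum.reindex[OF inj] o_def)
      moreover have "W s t = w s t" for s using that by (simp add: W_def)
      ultimately show ?thesis by simp
    qed
    then show False using x(1) independent_rowsD[OF ind, of "\<lambda>s. x (W s)"] by blast
  qed
  then have "\<exists>g. Vector_Spaces.linear (\<lambda>c f x. c * f x) (*) g \<and>
      (\<forall>x\<in>W ` S. g x = (if x = W s then 1 else 0))" for s
    by (rule pair.linear_independent_extend)
  then obtain g where g: "\<And>s. Vector_Spaces.linear (\<lambda>c f x. c * f x) (*) (g s)"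
    "\<And>s u. u \<in> S \<Longrightarrow> g s (W u) = (if W u = W s then 1 else 0)" by (metis imageI)
  have "(\<Sum>t\<in>T. g s (\<lambda>t'. if t' = t then 1 else 0) * w u t) = (if u = s then 1 else 0)"
    if "s \<in> S" "u \<in> S" for s u
  proof -
    interpret lin: Vector_Spaces.linear "\<lambda>c f x. c * f x" "(*)" "g s" by (rule g(1))
    have sum_app: "(\<Sum>t\<in>A. (\<lambda>t'. w u t * (if t' = t then 1 else 0))) t'
        = (\<Sum>t\<in>A. w u t * (if t' = t then 1 else 0))" for A t'
      by (induction A rule: infinite_finite_induct) simp_all
    have "W u = (\<Sum>t\<in>T. (\<lambda>t'. w u t * (if t' = t then 1 else 0)))"
      by (rule ext, subst sum_app) (simp add: W_def if_distrib assms(2) cong: if_cong)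
    then have "g s (W u) = (\<Sum>t\<in>T. w u t * g s (\<lambda>t'. if t' = t then 1 else 0))"
      by (simp only: lin.sum lin.scale)
    then show ?thesis using g(2)[OF that(2)] that inj by (simp add: mult.commute inj_on_eq_iff)
  qed
  then show ?thesis by (intro exI[of _ "\<lambda>s t. g s (\<lambda>t'. if t' = t then 1 else 0)"]) blast
qed

text \<open>
  Against the dual family at \<open>a0\<close>, the rows at a nearby point form a matrix close to the unit matrix.
\<close>

lemma eventually_independent_rows:
  fixes w :: "'a::topological_space \<Rightarrow> 's \<Rightarrow> 't \<Rightarrow> complex"
  assumes fin: "finite S" "finite T" and ind: "independent_rows T S (w a0)"
    and cont: "\<And>s t. s \<in> S \<Longrightarrow> t \<in> T \<Longrightarrow> ((\<lambda>a. w a s t) \<longlongrightarrow> w a0 s t) (nhds a0)"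
  shows "eventually (\<lambda>a. independent_rows T S (w a)) (nhds a0)"
proof -
  obtain \<psi> where \<psi>: "\<And>s u. s \<in> S \<Longrightarrow> u \<in> S \<Longrightarrow>
      (\<Sum>t\<in>T. \<psi> s t * w a0 u t) = (if u = s then 1 else 0)"
    using dual_family_exists[OF fin ind] by blast
  define M where "M a s u = (\<Sum>t\<in>T. \<psi> s t * w a u t)" for a s u
  \<comment> \<open>Since \<open>card S * r \<le> 1 / 2\<close>, a relation \<open>x\<close> with
    norm \<open>X\<close> will satisfy \<open>X \<le> 1 / 2 * X\<close>; the added 1 covers empty
    \<open>S\<close>.\<close>
  define r where "r = 1 / (2 * (real (card S) + 1))"
  have r: "r > 0" "real (card S) * r \<le> 1 / 2" by (simp_all add: r_def field_simps)
  have "eventually (\<lambda>a. \<forall>s\<in>S. \<forall>u\<in>S. dist (M a s u) (M a0 s u) < r) (nhds a0)"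
  proof (intro eventually_ball_finite fin ballI)
    fix s u assume "s \<in> S" "u \<in> S"
    then have "((\<lambda>a. M a s u) \<longlongrightarrow> M a0 s u) (nhds a0)"
      unfolding M_def by (intro tendsto_intros cont)
    then show "eventually (\<lambda>a. dist (M a s u) (M a0 s u) < r) (nhds a0)"
      using r(1) by (rule tendstoD)
  qed
  then show ?thesis
  proof (rule eventually_mono)
    fix a assume "\<forall>s\<in>S. \<forall>u\<in>S. dist (M a s u) (M a0 s u) < r"
    then have close: "cmod (M a s u - (if u = s then 1 else 0)) \<le> r" if "s \<in> S" "u \<in> S" for s u
      using that \<psi> by (simp add: M_def dist_norm less_imp_le)
    show "independent_rows T S (w a)"
      unfolding independent_rows_def
    proof (intro allI impI)
      fix x assume x: "\<forall>t\<in>T. (\<Sum>s\<in>S. x s * w a s t) = 0"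
      define X where "X = (\<Sum>u\<in>S. cmod (x u))"
      have "cmod (x s) \<le> r * X" if s: "s \<in> S" for s
      proof -
        have "(\<Sum>u\<in>S. x u * M a s u) = (\<Sum>u\<in>S. \<Sum>t\<in>T. \<psi> s t * (x u * w a u t))"
          by (simp add: M_def sum_distrib_left mult_ac)
        also have "\<dots> = (\<Sum>t\<in>T. \<psi> s t * (\<Sum>u\<in>S. x u * w a u t))"
          by (subst sum.swap) (simp add: sum_distrib_left)
        also have "\<dots> = 0" using x by simp
        finally have "(\<Sum>u\<in>S. x u * M a s u) = 0" .
        moreover have "(\<Sum>u\<in>S. x u * (if u = s then 1 else 0)) = x s"
          using s fin(1) by (simp add: if_distrib cong: if_cong)
        ultimately have "- x s = (\<Sum>u\<in>S. x u * (M a s u - (if u = s then 1 else 0)))"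
          by (simp add: right_diff_distrib sum_subtractf)
        then have "cmod (x s) = cmod (\<Sum>u\<in>S. x u * (M a s u - (if u = s then 1 else 0)))"
          by (metis norm_minus_cancel)
        also have "\<dots> \<le> (\<Sum>u\<in>S. cmod (x u) * r)"
          by (rule sum_norm_le) (simp only: norm_mult, rule mult_left_mono[OF close[OF s] norm_ge_zero])
        finally show ?thesis by (simp add: X_def sum_distrib_left mult.commute)
      qed
      then have "X \<le> (\<Sum>s\<in>S. r * X)" unfolding X_def by (rule sum_mono)
      also have "\<dots> = real (card S) * r * X" by simp
      also have "\<dots> \<le> 1 / 2 * X"
        using r(2) by (intro mult_right_mono) (auto simp: X_def sum_nonneg)
      finally have "X \<le> 0" by simp
      then have "X = 0" by (simp add: X_def sum_nonneg antisym)
      then show "\<forall>s\<in>S. x s = 0" using fin(1) by (simp add: X_def sum_nonneg_eq_0_iff)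
    qed
  qed
qed

section \<open>Injective matrices and their neighbourhoods\<close>

lemma tendsto_nhds_of_continuous_on:
  fixes f :: "'a::t2_space \<Rightarrow> 'b::topological_space"
  shows "continuous_on UNIV f \<Longrightarrow> (f \<longlongrightarrow> f a) (nhds a)"
  by (metis UNIV_I continuous_on_eq_continuous_at isCont_def open_UNIV tendsto_at_iff_tendsto_nhds)

text \<open>For a left inverse \<open>B\<close> of \<open>A0\<close> the determinant of
  \<open>B ** A\<close> is 1 at \<open>A0\<close>, hence nonzero nearby, which forces
  \<open>A\<close> to be injective.\<close>

lemma eventually_inj_matrix:
  fixes A0 :: "complex ^ 'k::finite ^ 'n::finite"
  assumes "inj ((*v) A0)"
  shows "eventually (\<lambda>A. inj ((*v) A)) (nhds A0)"
proof -
  obtain B :: "complex ^ 'n ^ 'k" where B: "B ** A0 = mat 1"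
    using assms matrix_left_invertible_injective by blast
  have "continuous_on UNIV (\<lambda>A. det (B ** A))"
    unfolding det_def matrix_matrix_mult_def by (simp, intro continuous_intros)
  then have "((\<lambda>A. det (B ** A)) \<longlongrightarrow> det (B ** A0)) (nhds A0)"
    by (rule tendsto_nhds_of_continuous_on)
  moreover have "det (B ** A0) \<noteq> 0" by (simp add: B)
  ultimately have "eventually (\<lambda>A. det (B ** A) \<noteq> 0) (nhds A0)"
    by (rule tendsto_imp_eventually_ne)
  then show ?thesis
  proof (rule eventually_mono)
    fix A assume "det (B ** A) \<noteq> 0"
    then have "inj ((*v) (B ** A))" by (simp add: inj_matrix_vector_mult invertible_det_nz)
    then show "inj ((*v) A)"
      by (intro injI) (metis injD matrix_vector_mul_assoc)
  qed
qed

text \<open>The inclusion of coordinates along an injection of the index types.\<close>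

lemma inj_matrix_exists:
  assumes "CARD('k::finite) \<le> CARD('n::finite)"
  shows "\<exists>A :: complex ^ 'k ^ 'n. inj ((*v) A)"
proof -
  obtain f :: "'k \<Rightarrow> 'n" where f: "inj f"
    using assms card_le_inj[of "UNIV :: 'k set" "UNIV :: 'n set"] by auto
  let ?A = "(\<chi> i j. if i = f j then 1 else 0) :: complex ^ 'k ^ 'n"
  have "(?A *v y) $ f j = y $ j" for y j
  proof -
    have "(?A *v y) $ f j = (\<Sum>j'\<in>UNIV. (if f j = f j' then 1 else 0) * y $ j')"
      by (simp add: matrix_vector_mult_def)
    also have "\<dots> = (\<Sum>j'\<in>UNIV. if j' = j then y $ j else 0)"
      by (rule sum.cong) (use f in \<open>auto simp: inj_eq\<close>)
    finally show ?thesis by simp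
  qed
  then have "inj ((*v) ?A)" by (intro injI) (metis vec_eq_iff)
  then show ?thesis by blast
qed

text \<open>
  If the rank \<open>card S\<close> of the pullbacks were maximal but not full, some functional vanishing on
  them for \<open>A = A0\<close> would not vanish on the \<open>e\<close>-th power of some linear form \<open>b\<close>. Normalised to
  be one on this power, such functionals along \<open>A0 + a \<cdot> b\<close> would give a relation of bounded degree
  in \<open>a\<close> with fewer coefficients than variables.
\<close>

lemma spanning_pullbacks_exist:
  fixes G :: "'n::finite \<Rightarrow> 'n mpoly"
  assumes hom: "\<And>i. homogeneous e (G i)"
    and nz: "\<And>a j. a j \<noteq> 0 \<Longrightarrow> \<exists>i. eval a (G i) \<noteq> 0"
    and cardT: "card {m :: 'k::finite monomial. mdeg m = e} \<le> CARD('n)"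
    and cardk: "CARD('k) \<le> CARD('n)"
  obtains U :: "(complex ^ 'k ^ 'n) set" where "open U" "U \<noteq> {}"
    "\<And>A. A \<in> U \<Longrightarrow> inj ((*v) A)"
    "\<And>A m. A \<in> U \<Longrightarrow> mdeg m = e \<Longrightarrow>
       \<exists>x. single m 1 = (\<Sum>i\<in>UNIV. single 0 (x i) * pullback A (G i))"
proof -
  let ?T = "{m :: 'k monomial. mdeg m = e}"
  define v where "v A i m = lookup (pullback A (G i)) m" for A :: "complex ^ 'k ^ 'n" and i m
  have finT: "finite ?T" by (rule finite_mdeg_eq)
  define good where "good A S \<longleftrightarrow> inj ((*v) A) \<and> independent_rows ?T S (v A)"
    for A and S :: "'n set"
  obtain A' :: "complex ^ 'k ^ 'n" where "inj ((*v) A')" using inj_matrix_exists[OF cardk] by blast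
  then have "good A' {}" by (simp add: good_def independent_rows_def)
  \<comment> \<open>The largest number of independent rows at an injective matrix exists: the empty
    family is a start, and the number of all rows is a bound.\<close>
  then have "\<exists>N. (\<exists>A S. good A S \<and> card S = N) \<and> (\<forall>N'. (\<exists>A S. good A S \<and> card S = N') \<longrightarrow> N' \<le> N)"
    by (intro ex_has_greatest_nat[where b = "Suc CARD('n)"]) (auto simp: less_Suc_eq_le intro!: card_mono)
  then obtain A0 S where good: "good A0 S"
    and max: "\<And>A S'. good A S' \<Longrightarrow> card S' \<le> card S" by blast
  have finS: "finite S" by simp
  have v_cont: "((\<lambda>A. v A i m) \<longlongrightarrow> v A0 i m) (nhds A0)" for i m
    unfolding v_def by (intro tendsto_nhds_of_continuous_on continuous_lookup_pullback)
  have "card ?T \<le> card S"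
  proof (rule ccontr)
    assume less: "\<not> card ?T \<le> card S"
    \<comment> \<open>A nonzero functional killing the rows in \<open>S\<close>: there are
      \<open>card ?T\<close> unknowns and only \<open>card S\<close> equations.\<close>
    then obtain \<phi> m0 where \<phi>: "mdeg m0 = e" "\<phi> m0 \<noteq> 0"
      and \<phi>0: "\<And>i. i \<in> S \<Longrightarrow> (\<Sum>m\<in>?T. \<phi> m * v A0 i m) = 0"
      using underdetermined_system[OF finS finT, of "\<lambda>m i. v A0 i m"] by auto
    obtain b where b: "(\<Sum>m\<in>?T. \<phi> m * lookup (linear_form b ^ e) m) \<noteq> 0"
      using functional_nonzero_on_linear_form_power[of m0 e \<phi>] \<phi> by blast
    define \<theta> where "\<theta> m = lookup (linear_form b ^ e) m" for m
    define At where "At a = (\<chi> i j. A0 $ i $ j + a $ i * b j)" for a :: "complex ^ 'n"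
    \<comment> \<open>The rows at \<open>At a\<close>, with the power of the linear form as an
      additional row at the index \<open>None\<close>.\<close>
    define w where "w a z m = (case z of None \<Rightarrow> \<theta> m | Some i \<Rightarrow> v (At a) i m)" for a z m
    let ?S = "insert None (Some ` S)"
    have sum_S: "(\<Sum>z\<in>?S. x z * w a z m) = x None * \<theta> m + (\<Sum>i\<in>S. x (Some i) * v (At a) i m)"
      for x a m
      using finS by (simp add: sum.reindex w_def)
    have At0: "At 0 = A0" by (simp add: At_def vec_eq_iff)
    \<comment> \<open>Pairing a relation with \<open>\<phi>\<close>, which kills the rows in
      \<open>S\<close> at \<open>A0\<close> but not \<open>\<theta>\<close>, isolates
      \<open>x None\<close>.\<close>
    have ind0: "independent_rows ?T ?S (w 0)"
      unfolding independent_rows_def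
    proof (intro allI impI)
      fix x assume x: "\<forall>m\<in>?T. (\<Sum>z\<in>?S. x z * w 0 z m) = 0"
      have "0 = (\<Sum>m\<in>?T. \<phi> m * (\<Sum>z\<in>?S. x z * w 0 z m))" using x by simp
      also have "\<dots> = x None * (\<Sum>m\<in>?T. \<phi> m * \<theta> m) + (\<Sum>m\<in>?T. \<Sum>i\<in>S. x (Some i) * (\<phi> m * v A0 i m))"
        by (simp only: sum_S At0) (simp add: distrib_left sum.distrib sum_distrib_left mult_ac)
      also have "(\<Sum>m\<in>?T. \<Sum>i\<in>S. x (Some i) * (\<phi> m * v A0 i m))
          = (\<Sum>i\<in>S. x (Some i) * (\<Sum>m\<in>?T. \<phi> m * v A0 i m))"
        by (subst sum.swap) (simp add: sum_distrib_left)
      finally have "x None = 0" using b \<phi>0 by (simp add: \<theta>_def)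
      moreover from this have "x (Some i) = 0" if "i \<in> S" for i
        using x good that independent_rowsD[of ?T S "v A0" "\<lambda>i. x (Some i)"]
        by (auto simp: good_def sum_S At0)
      ultimately show "\<forall>z\<in>?S. x z = 0" by blast
    qed
    have At_cont: "continuous_on UNIV At"
      unfolding At_def by (intro continuous_intros)
    have "eventually (\<lambda>a. independent_rows ?T ?S (w a)) (nhds 0)"
    proof (rule eventually_independent_rows)
      show "independent_rows ?T ?S (w 0)" by (rule ind0)
      fix z m
      show "((\<lambda>a. w a z m) \<longlongrightarrow> w 0 z m) (nhds 0)"
        unfolding w_def v_def
        by (cases z) (auto intro!: tendsto_nhds_of_continuous_on
            continuous_on_compose2[OF continuous_lookup_pullback At_cont])
    qed (use finS finT in simp_all)
    moreover have "eventually (\<lambda>a. inj ((*v) (At a))) (nhds 0)"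
    proof (rule eventually_compose_filterlim[where P = "\<lambda>A. inj ((*v) A)" and f = At])
      show "eventually (\<lambda>A. inj ((*v) A)) (nhds A0)"
        using good by (intro eventually_inj_matrix) (simp add: good_def)
      show "filterlim At (nhds A0) (nhds 0)"
        using tendsto_nhds_of_continuous_on[OF At_cont, of 0] by (simp add: At0)
    qed
    ultimately have "eventually (\<lambda>a. independent_rows ?T ?S (w a) \<and> inj ((*v) (At a))) (nhds 0)"
      by (rule eventually_conj)
    then obtain U where U: "open U" "0 \<in> U"
      and Uind: "\<And>a. a \<in> U \<Longrightarrow> independent_rows ?T ?S (w a)"
      and Uinj: "\<And>a. a \<in> U \<Longrightarrow> inj ((*v) (At a))"
      unfolding eventually_nhds by blast
    have "\<exists>\<psi>. (\<Sum>m\<in>?T. \<psi> m * \<theta> m) = 1 \<and> (\<forall>i. (\<Sum>m\<in>?T. \<psi> m * v (At a) i m) = 0)"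
      if a: "a \<in> U" for a
    proof -
      have "finite ?S" using finS by simp
      from dual_family_exists[OF this finT Uind[OF a]]
      obtain \<psi> where "\<forall>s\<in>?S. \<forall>u\<in>?S. (\<Sum>m\<in>?T. \<psi> s m * w a u m) = (if u = s then 1 else 0)"
        by (rule exE)
      then have \<psi>: "(\<Sum>m\<in>?T. \<psi> s m * w a u m) = (if u = s then 1 else 0)"
        if "s \<in> ?S" "u \<in> ?S" for s u
        by (rule bspec[OF bspec[OF _ that(1)] that(2)])
      have on_S: "(\<Sum>m\<in>?T. \<psi> None m * v (At a) i m) = 0" if "i \<in> S" for i
        using \<psi>[of None "Some i"] that by (simp add: w_def)
      have ind: "independent_rows ?T S (v (At a))"
        unfolding independent_rows_def
      proof (intro allI impI ballI)
        fix x i assume x: "\<forall>m\<in>?T. (\<Sum>i\<in>S. x i * v (At a) i m) = 0" and i: "i \<in> S"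
        show "x i = 0"
          using independent_rowsD[OF Uind[OF a], of "\<lambda>z. case z of None \<Rightarrow> 0 | Some i \<Rightarrow> x i" "Some i"]
            x i by (auto simp: sum_S)
      qed
      have "(\<Sum>m\<in>?T. \<psi> None m * v (At a) i m) = 0" for i
      proof (cases "i \<in> S")
        case False
        \<comment> \<open>By maximality of \<open>card S\<close>, every further row at
          \<open>At a\<close> depends on those in \<open>S\<close>, so the dual vector at
          \<open>None\<close> kills it too.\<close>
        then have "\<not> independent_rows ?T (insert i S) (v (At a))"
          using max[of "At a" "insert i S"] Uinj[OF a] finS by (auto simp: good_def)
        then obtain x where x: "\<And>m. m \<in> ?T \<Longrightarrow> v (At a) i m = (\<Sum>s\<in>S. x s * v (At a) s m)"
          using in_span_of_independent_rows[OF finS ind _ False] by blast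
        have "(\<Sum>m\<in>?T. \<psi> None m * v (At a) i m) = (\<Sum>m\<in>?T. \<Sum>s\<in>S. x s * (\<psi> None m * v (At a) s m))"
          by (rule sum.cong) (simp_all add: x sum_distrib_left mult_ac)
        also have "\<dots> = (\<Sum>s\<in>S. x s * (\<Sum>m\<in>?T. \<psi> None m * v (At a) s m))"
          by (subst sum.swap) (simp add: sum_distrib_left)
        finally show ?thesis using on_S by simp
      qed (rule on_S)
      moreover have "(\<Sum>m\<in>?T. \<psi> None m * \<theta> m) = 1"
        using \<psi>[of None None] by (simp add: w_def)
      ultimately show ?thesis by blast
    qed
    then have "\<exists>\<psi>. \<forall>a\<in>U. (\<Sum>m\<in>?T. \<psi> a m * \<theta> m) = 1 \<and>
        (\<forall>i. (\<Sum>m\<in>?T. \<psi> a m * v (At a) i m) = 0)"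
      by (intro bchoice ballI)
    then obtain \<psi> where \<psi>: "\<forall>a\<in>U. (\<Sum>m\<in>?T. \<psi> a m * \<theta> m) = 1 \<and>
        (\<forall>i. (\<Sum>m\<in>?T. \<psi> a m * v (At a) i m) = 0)"
      by (rule exE)
    have \<psi>1: "(\<Sum>m\<in>?T. \<psi> a m * \<theta> m) = 1"
      and \<psi>0: "(\<Sum>m\<in>?T. \<psi> a m * v (At a) i m) = 0" if "a \<in> U" for a i
      using bspec[OF \<psi> that] by simp_all
    \<comment> \<open>The coefficient \<open>\<psi> a t\<close> will be eliminated by the
      normalisation \<open>\<psi>1\<close>. This leaves \<open>card ?T - 1\<close> coefficients,
      fewer than the variables.\<close>
    obtain t where t: "t \<in> ?T" "\<theta> t \<noteq> 0"
      using b sum.neutral[of ?T "\<lambda>m. \<phi> m * lookup (linear_form b ^ e) m"] by (auto simp: \<theta>_def)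
    define \<rho> where "\<rho> i m a = v (At a) i m - eval (\<lambda>j. a $ j) (G i) * \<theta> m" for i m a
    have \<rho>: "poly_fun e (\<rho> i m)" for i m
      unfolding \<rho>_def v_def At_def \<theta>_def by (rule lookup_pullback_rank_one[OF hom])
    show False
    proof (rule no_bounded_degree_relation[where e = e and G = G and I = "?T - {t}" and U = U
          and h = "\<lambda>i a. - (1 / \<theta> t) * \<rho> i t a" and c = "\<lambda>m a. \<psi> a m"
          and g = "\<lambda>i m a. \<theta> m / \<theta> t * \<rho> i t a - \<rho> i m a"])
      show "homogeneous e (G i)" for i by (rule hom)
      show "\<exists>i. eval a (G i) \<noteq> 0" if "a j \<noteq> 0" for a j by (rule nz[of a j]) (rule that)
      have "card (?T - {t}) < card ?T" using t(1) finT by (intro psubset_card_mono) auto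
      then show "card (?T - {t}) < CARD('n)" using cardT by simp
      show "poly_fun e (\<lambda>a. - (1 / \<theta> t) * \<rho> i t a)" for i by (intro poly_fun_cmult \<rho>)
      show "poly_fun e (\<lambda>a. \<theta> m / \<theta> t * \<rho> i t a - \<rho> i m a)" for i m
        by (intro poly_fun_diff poly_fun_cmult \<rho>)
      fix a i assume a: "a \<in> U"
      let ?g = "eval (\<lambda>j. a $ j) (G i)"
      let ?X = "\<Sum>m\<in>?T - {t}. \<psi> a m * \<theta> m" and ?Y = "\<Sum>m\<in>?T - {t}. \<psi> a m * \<rho> i m a"
      have "(\<Sum>m\<in>?T. \<psi> a m * v (At a) i m) = ?g * (\<Sum>m\<in>?T. \<psi> a m * \<theta> m) + (\<Sum>m\<in>?T. \<psi> a m * \<rho> i m a)"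
        by (simp add: \<rho>_def right_diff_distrib sum_subtractf sum_distrib_left mult_ac)
      \<comment> \<open>The normalisation makes the coefficient of \<open>?g\<close> equal to 1, so
        \<open>?g\<close> is minus the pairing of \<open>\<psi> a\<close> with the terms
        \<open>\<rho>\<close> of degree less than \<open>e\<close>.\<close>
      then have "?g + (\<psi> a t * \<rho> i t a + ?Y) = 0"
        using \<psi>0[OF a] \<psi>1[OF a] t(1) finT by (simp add: sum.remove[of ?T t])
      then have g: "?g = - (\<psi> a t * \<rho> i t a + ?Y)" by (simp only: eq_neg_iff_add_eq_0)
      have "\<psi> a t * \<theta> t + ?X = 1"
        using \<psi>1[OF a] t(1) finT by (simp add: sum.remove[of ?T t])
      then have \<psi>t: "\<psi> a t = (1 - ?X) / \<theta> t" using t(2) by (simp add: field_simps)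
      have "(\<Sum>m\<in>?T - {t}. \<psi> a m * (\<theta> m / \<theta> t * \<rho> i t a - \<rho> i m a)) = ?X / \<theta> t * \<rho> i t a - ?Y"
      proof -
        have "(\<Sum>m\<in>?T - {t}. \<psi> a m * (\<theta> m / \<theta> t * \<rho> i t a - \<rho> i m a))
            = (\<Sum>m\<in>?T - {t}. \<psi> a m * \<theta> m * (\<rho> i t a / \<theta> t)) - ?Y"
          by (simp add: right_diff_distrib sum_subtractf mult.assoc)
        also have "(\<Sum>m\<in>?T - {t}. \<psi> a m * \<theta> m * (\<rho> i t a / \<theta> t)) = ?X * (\<rho> i t a / \<theta> t)"
          by (simp only: sum_distrib_right)
        finally show ?thesis by simp
      qed
      then show "?g = - (1 / \<theta> t) * \<rho> i t a
          + (\<Sum>m\<in>?T - {t}. \<psi> a m * (\<theta> m / \<theta> t * \<rho> i t a - \<rho> i m a))"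
        unfolding g \<psi>t by (simp only:) (simp add: diff_divide_distrib left_diff_distrib)
    qed (use finT U in auto)
  qed
  then have span: "\<exists>x. single m 1 = (\<Sum>i\<in>UNIV. single 0 (x i) * pullback A (G i))"
    if A: "independent_rows ?T S (v A)" and m: "mdeg m = e" for A m
  proof -
    \<comment> \<open>The unit vector of \<open>m\<close> joins the rows at the index
      \<open>None\<close>; with more rows than columns it has to depend on the others.\<close>
    let ?w = "\<lambda>z m'. case z of None \<Rightarrow> (if m' = m then 1 else 0) | Some i \<Rightarrow> v A i m'"
    have ind: "independent_rows ?T (Some ` S) ?w"
      unfolding independent_rows_def
    proof (intro allI impI ballI)
      fix x z assume x: "\<forall>m'\<in>?T. (\<Sum>z\<in>Some ` S. x z * ?w z m') = 0" and z: "z \<in> Some ` S"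
      then show "x z = 0"
        using independent_rowsD[OF A, of "\<lambda>i. x (Some i)"] by (auto simp: sum.reindex)
    qed
    have "\<not> independent_rows ?T (insert None (Some ` S)) ?w"
    proof
      assume i: "independent_rows ?T (insert None (Some ` S)) ?w"
      have "card ?T < card (insert None (Some ` S))"
        using \<open>card ?T \<le> card S\<close> finS by (simp add: card_image)
      then obtain x where "\<exists>s\<in>insert None (Some ` S). x s \<noteq> 0"
        "\<And>t. t \<in> ?T \<Longrightarrow> (\<Sum>s\<in>insert None (Some ` S). x s * ?w s t) = 0"
        using underdetermined_system[OF finT, of "insert None (Some ` S)" ?w] finS by auto
      then show False using independent_rowsD[OF i, of x] by blast
    qed
    then obtain x where x: "\<And>m'. m' \<in> ?T \<Longrightarrow> ?w None m' = (\<Sum>z\<in>Some ` S. x z * ?w z m')"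
      using in_span_of_independent_rows[OF _ ind] finS by blast
    let ?x = "\<lambda>i. if i \<in> S then x (Some i) else 0"
    have "single m 1 = (\<Sum>i\<in>UNIV. single 0 (?x i) * pullback A (G i))"
    proof (rule poly_mapping_eqI)
      fix m'
      have "lookup (\<Sum>i\<in>UNIV. single 0 (?x i) * pullback A (G i)) m' = (\<Sum>i\<in>S. x (Some i) * v A i m')"
        by (simp add: lookup_sum v_def if_distrib if_distribR sum.If_cases cong: if_cong)
      also have "\<dots> = (if m' = m then 1 else 0)"
      proof (cases "mdeg m' = e")
        case True
        then show ?thesis using x[of m'] by (simp add: sum.reindex)
      next
        case False
        then have "v A i m' = 0" for i
          using homogeneous_pullback[OF hom[of i], of A]
          by (auto simp: v_def homogeneous_def in_keys_iff)
        then show ?thesis using False m by auto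
      qed
      finally show "lookup (single m 1) m' = lookup (\<Sum>i\<in>UNIV. single 0 (?x i) * pullback A (G i)) m'"
        by (simp add: lookup_single when_def)
    qed
    then show ?thesis by (intro exI[of _ ?x])
  qed
  have "eventually (\<lambda>A. independent_rows ?T S (v A) \<and> inj ((*v) A)) (nhds A0)"
    using good v_cont
    by (intro eventually_conj eventually_inj_matrix eventually_independent_rows[OF finS finT])
      (simp_all add: good_def)
  then obtain U where "open U" "A0 \<in> U" "\<And>A. A \<in> U \<Longrightarrow> independent_rows ?T S (v A) \<and> inj ((*v) A)"
    unfolding eventually_nhds by blast
  then show thesis using span by (intro that[of U]) auto
qed

text \<open>By \<open>span\<close>, composing \<open>F\<close> with \<open>A\<close> is a submersion
  from \<open>U\<close> to the forms of degree \<open>d\<close>, and a nonzero polynomial in their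
  coefficients cannot vanish along it.\<close>

lemma coordinate_polynomial_nonvanishing:
  fixes F :: "'n::finite mpoly" and Q :: "'k::finite coeff_poly" and U :: "(complex ^ 'k ^ 'n) set"
  assumes "d > 0" "open U" "U \<noteq> {}"
    and span: "\<And>A m. A \<in> U \<Longrightarrow> mdeg m = d - 1 \<Longrightarrow>
       \<exists>x. single m 1 = (\<Sum>i\<in>UNIV. single 0 (x i) * pullback A (partial_deriv i F))"
    and Q: "Q \<in> coordinate_ring d" "Q \<noteq> 0"
  shows "\<exists>A\<in>U. eval (lookup (pullback A F)) Q \<noteq> 0"
proof (rule ccontr)
  assume no: "\<not> ?thesis"
  have "Q = 0"
  proof (rule vanishing_along_submersion[OF assms(2,3) finite_mdeg_eq[of d],
        of "\<lambda>A. lookup (pullback A F)"])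
    fix A and m :: "'k monomial" assume A: "A \<in> U" and "m \<in> {m. mdeg m = d}"
    then have m: "mdeg m = d" by simp
    then obtain j where j: "j \<in> keys m"
      using \<open>d > 0\<close> mdeg_zero by (metis all_not_in_conv keys_eq_empty less_irrefl)
    then have mj: "m - single j 1 + single j 1 = m"
      by (intro mono_minus_plus_single) (simp add: in_keys_iff)
    then have "mdeg (m - single j 1) = d - 1"
      using m mdeg_add[of "m - single j 1" "single j 1"] by simp
    then obtain x where x: "single (m - single j 1) 1
        = (\<Sum>i\<in>UNIV. single 0 (x i) * pullback A (partial_deriv i F))"
      using span[OF A] by blast
    \<comment> \<open>To move the pullback in direction \<open>m\<close>, the quotient of
      \<open>m\<close> by its variable \<open>j\<close> is expanded in the pulled back derivatives,
      and the coefficients \<open>x\<close> form column \<open>j\<close>.\<close>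
    define B where "B = (\<chi> i j'. if j' = j then x i else 0)"
    define \<gamma> where "\<gamma> t = (\<chi> i j. A $ i $ j + t * B $ i $ j)" for t
    have lB: "linear_form (\<lambda>j. B $ i $ j) = single (single j 1) 1 * single 0 (x i)" for i
    proof -
      have "linear_form (\<lambda>j. B $ i $ j) = (\<Sum>j'\<in>UNIV. if j' = j then single (single j 1) (x i) else 0)"
        unfolding linear_form_def B_def by (rule sum.cong) auto
      then show ?thesis by (simp add: mult_single)
    qed
    have "(\<Sum>i\<in>UNIV. linear_form (\<lambda>j. B $ i $ j) * pullback A (partial_deriv i F))
        = single (single j 1) 1 * single (m - single j 1) 1"
      unfolding x lB by (simp only: sum_distrib_left mult.assoc)
    also have "\<dots> = single m 1"
      using mj by (simp add: mult_single add.commute)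
    finally have D: "((\<lambda>t. lookup (pullback (\<gamma> t) F) m') has_field_derivative
        (if m' = m then 1 else 0)) (at 0)" for m'
      using lookup_pullback_has_field_derivative[of A B F m']
      by (auto simp: \<gamma>_def lookup_single when_def split: if_splits)
    have "continuous_on UNIV \<gamma>" unfolding \<gamma>_def by (intro continuous_intros)
    then have "isCont \<gamma> 0" by (simp add: continuous_on_eq_continuous_at)
    moreover have "\<gamma> 0 = A" by (simp add: \<gamma>_def vec_eq_iff)
    ultimately show "\<exists>\<gamma>. isCont \<gamma> (0::complex) \<and> \<gamma> 0 = A \<and> (\<forall>m'\<in>{m. mdeg m = d}.
        ((\<lambda>t. lookup (pullback (\<gamma> t) F) m') has_field_derivative (if m' = m then 1 else 0)) (at 0))"
      using D by blast
  qed (use Q(1) no in \<open>auto simp: coordinate_ring_def\<close>)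
  then show False using Q(2) by simp
qed

section \<open>Invariants\<close>

lemma coordinate_ring_zero: "0 \<in> coordinate_ring d"
  and coordinate_ring_one: "1 \<in> coordinate_ring d"
  by (simp_all add: coordinate_ring_def)

lemma coordinate_ring_add: "p \<in> coordinate_ring d \<Longrightarrow> q \<in> coordinate_ring d \<Longrightarrow> p + q \<in> coordinate_ring d"
  using keys_add[of p q] unfolding coordinate_ring_def by blast

lemma coordinate_ring_uminus: "p \<in> coordinate_ring d \<Longrightarrow> - p \<in> coordinate_ring d"
  by (simp add: coordinate_ring_def in_keys_iff)

lemma coordinate_ring_mult:
  assumes "p \<in> coordinate_ring d" "q \<in> coordinate_ring d" shows "p * q \<in> coordinate_ring d"
  unfolding coordinate_ring_def
proof (intro CollectI ballI)
  fix M m assume "M \<in> keys (p * q)" and m: "m \<in> keys M"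
  then obtain K L where "M = K + L" "K \<in> keys p" "L \<in> keys q" using keys_mult[of p q] by blast
  then show "mdeg m = d" using m keys_add[of K L] assms unfolding coordinate_ring_def by blast
qed

lemma coordinate_ring_component: "p \<in> coordinate_ring d \<Longrightarrow> component e p \<in> coordinate_ring d"
  unfolding coordinate_ring_def by (auto simp: in_keys_iff lookup_component split: if_splits)

section \<open>Restriction of polynomials to a ray\<close>

interpretation poly_hom: coeff_hom "\<lambda>c::complex. [:c:]"
  by unfold_locales simp_all

text \<open>The values of \<open>Q\<close> at the multiples of \<open>a\<close>, as a polynomial in
  the scalar: a ring homomorphism into a domain, with the values of the graded components at
  \<open>a\<close> as coefficients.\<close>

definition ray_poly :: "('v \<Rightarrow> complex) \<Rightarrow> 'v mpoly \<Rightarrow> complex poly" where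
  "ray_poly a Q = mpoly_hom (\<lambda>c. [:c:]) (\<lambda>i. Polynomial.monom (a i) 1) Q"

lemmas ray_poly_simps = poly_hom.mpoly_hom_simps[of "\<lambda>i. Polynomial.monom (a i) 1" for a, folded ray_poly_def]

lemma monom_eval_monom:
  "monom_eval (\<lambda>i. Polynomial.monom (a i) 1) m = Polynomial.monom (monom_eval a m) (mdeg m)"
proof -
  have "(\<Prod>i\<in>A. Polynomial.monom (a i) 1 ^ n i) = Polynomial.monom (\<Prod>i\<in>A. a i ^ n i) (\<Sum>i\<in>A. n i)"
    for A n
    by (induction A rule: infinite_finite_induct) (simp_all add: monom_power mult_monom one_pCons monom_0)
  then show ?thesis by (simp add: monom_eval_def mdeg_def)
qed

lemma coeff_ray_poly: "coeff (ray_poly a Q) e = eval a (component e Q)"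
proof (induction Q rule: mpoly_induct)
  case (single m c)
  have "component e (single m c) = (if e = mdeg m then single m c else 0)"
    by (rule component_homogeneous[OF homogeneous_single[OF refl]])
  then show ?case
    by (simp add: ray_poly_simps monom_eval_monom[unfolded One_nat_def] eval_simps smult_monom)
qed (simp_all add: ray_poly_simps component_add eval_simps)

lemma poly_ray_poly: "poly (ray_poly a Q) t = eval (\<lambda>i. t * a i) Q"
proof (induction Q rule: mpoly_induct)
  case (single m c)
  show ?case
    by (simp add: ray_poly_simps monom_eval_monom[unfolded One_nat_def] eval_simps smult_monom
        monom_eval_scale poly_monom mult_ac)
qed (simp_all add: ray_poly_simps eval_simps)

section \<open>The graded ring of invariants\<close>

lemma invariants_coordinate_ring: "Q \<in> invariants d \<Longrightarrow> Q \<in> coordinate_ring d"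
  by (simp add: invariants_def)

lemma invariantsD:
  fixes A :: "complex ^ 'v::finite ^ 'v" and Q :: "'v coeff_poly"
  shows "Q \<in> invariants d \<Longrightarrow> det A = 1 \<Longrightarrow> homogeneous d f \<Longrightarrow>
    eval (lookup (pullback A f)) Q = eval (lookup f) Q"
  unfolding invariants_def by blast

lemma invariants_zero: "0 \<in> invariants d" and invariants_one: "1 \<in> invariants d"
  by (simp_all add: invariants_def coordinate_ring_zero coordinate_ring_one eval_simps)

lemma invariants_add: "p \<in> invariants d \<Longrightarrow> q \<in> invariants d \<Longrightarrow> p + q \<in> invariants d"
  by (simp add: invariants_def coordinate_ring_add eval_simps)

lemma invariants_mult: "p \<in> invariants d \<Longrightarrow> q \<in> invariants d \<Longrightarrow> p * q \<in> invariants d"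
  by (simp add: invariants_def coordinate_ring_mult eval_simps)

lemma invariants_uminus: "p \<in> invariants d \<Longrightarrow> - p \<in> invariants d"
  by (simp add: invariants_def coordinate_ring_uminus eval_simps)

text \<open>Scaling commutes with pullback, so \<open>Q\<close> is invariant along the whole ray
  through \<open>f\<close>; comparing coefficients in the scalar separates the components.\<close>

lemma invariants_component:
  fixes Q :: "'v::finite coeff_poly"
  assumes Q: "Q \<in> invariants d" shows "component e Q \<in> invariants d"
  unfolding invariants_def
proof (intro CollectI conjI allI impI)
  show "component e Q \<in> coordinate_ring d"
    using Q by (intro coordinate_ring_component invariants_coordinate_ring)
  fix A :: "complex ^ 'v ^ 'v" and f :: "'v mpoly" assume A: "det A = 1" and f: "homogeneous d f"
  have scale: "(\<lambda>m. t * lookup g m) = lookup (single 0 t * g)" for t and g :: "'v mpoly"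
    by (rule ext) simp
  have "poly (ray_poly (lookup (pullback A f)) Q) t = poly (ray_poly (lookup f) Q) t" for t
    unfolding poly_ray_poly scale pullback_smult[symmetric]
    by (rule invariantsD[OF Q A homogeneous_smult[OF f]])
  then have "ray_poly (lookup (pullback A f)) Q = ray_poly (lookup f) Q"
    by (metis ext poly_eq_poly_eq_iff)
  then show "eval (lookup (pullback A f)) (component e Q) = eval (lookup f) (component e Q)"
    by (metis coeff_ray_poly)
qed

lemma invariant_ring_simps [simp]:
  "carrier (invariant_ring d) = invariants d"
  "p \<otimes>\<^bsub>invariant_ring d\<^esub> q = p * q" "p \<oplus>\<^bsub>invariant_ring d\<^esub> q = p + q"
  "\<one>\<^bsub>invariant_ring d\<^esub> = 1" "\<zero>\<^bsub>invariant_ring d\<^esub> = 0"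
  by (simp_all add: invariant_ring_def)

lemma cring_invariant_ring: "cring (invariant_ring d :: ('v::finite coeff_poly) ring)"
proof (rule cringI)
  show "abelian_group (invariant_ring d :: ('v coeff_poly) ring)"
  proof (rule abelian_groupI)
    fix x :: "'v coeff_poly" assume "x \<in> carrier (invariant_ring d)"
    then show "\<exists>y\<in>carrier (invariant_ring d). y \<oplus>\<^bsub>invariant_ring d\<^esub> x = \<zero>\<^bsub>invariant_ring d\<^esub>"
      by (intro bexI[of _ "- x"]) (simp_all add: invariants_uminus)
  qed (simp_all add: invariants_zero invariants_add add.assoc add.commute)
  show "comm_monoid (invariant_ring d :: ('v coeff_poly) ring)"
    by (rule comm_monoidI) (simp_all add: invariants_one invariants_mult mult.assoc mult.commute)
qed (simp add: distrib_right)

section \<open>Moduli points as homogeneous prime ideals\<close>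

lemma moduli_point_ray_poly: "moduli_point d f = {Q \<in> invariants d. ray_poly (lookup f) Q = 0}"
  by (auto simp: moduli_point_def poly_eq_iff coeff_ray_poly)

text \<open>The moduli point of \<open>f\<close> is the kernel of the restriction of the invariants to the line through \<open>f\<close>.\<close>

lemma primeideal_moduli_point: "primeideal (moduli_point d f) (invariant_ring d)"
proof (rule primeidealI2)
  interpret R: cring "invariant_ring d" by (rule cring_invariant_ring)
  have inv: "\<ominus>\<^bsub>invariant_ring d\<^esub> x = - x" if "x \<in> invariants d" for x
    using that by (intro R.minus_equality) (simp_all add: invariants_uminus)
  show "additive_subgroup (moduli_point d f) (invariant_ring d)"
  proof (rule additive_subgroup.intro, rule subgroup.intro)
    fix x assume x: "x \<in> moduli_point d f"
    then have "inv\<^bsub>add_monoid (invariant_ring d)\<^esub> x = - x"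
      using inv[of x] unfolding a_inv_def moduli_point_def by blast
    then show "inv\<^bsub>add_monoid (invariant_ring d)\<^esub> x \<in> moduli_point d f"
      using x by (simp add: moduli_point_ray_poly invariants_uminus ray_poly_simps)
  qed (auto simp: moduli_point_ray_poly invariants_add invariants_zero ray_poly_simps)
  have "1 \<notin> moduli_point d f" by (simp add: moduli_point_ray_poly ray_poly_simps)
  then show "carrier (invariant_ring d) \<noteq> moduli_point d f" using invariants_one by auto
qed (auto simp: cring_invariant_ring moduli_point_ray_poly invariants_mult ray_poly_simps)

lemma homogeneous_ideal_moduli_point: "homogeneous_ideal (moduli_point d f)"
  unfolding homogeneous_ideal_def
proof (intro ballI allI)
  fix Q e assume Q: "Q \<in> moduli_point d f"
  then have "eval (lookup f) (component e' (component e Q)) = 0" for e'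
    by (simp add: moduli_point_def component_homogeneous[OF homogeneous_component] eval_simps)
  then show "component e Q \<in> moduli_point d f"
    using Q by (simp add: moduli_point_def invariants_component)
qed

lemma semistable_moduli_point:
  assumes f: "homogeneous d f" and Q: "Q \<in> invariants d" "homogeneous e Q" "e > 0"
    and nz: "eval (lookup f) Q \<noteq> 0"
  shows "semistable d f" "moduli_point d f \<in> proj_basic_open (invariant_ring d) Q"
proof -
  have "f \<noteq> 0"
  proof
    assume "f = 0"
    \<comment> \<open>Zero is written as 0 times itself, so that homogeneity of positive degree
      makes \<open>Q\<close> vanish there.\<close>
    then have "lookup f = (\<lambda>m. 0 * lookup f m)" by (intro ext) simp
    then have "eval (lookup f) Q = eval (\<lambda>m. 0 * lookup f m) Q" by (rule arg_cong)
    also have "\<dots> = 0" using Q(3) by (simp only: eval_scale_homogeneous[OF Q(2)]) simp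
    finally show False using nz by simp
  qed
  with f Q nz show "semistable d f" by (auto simp: semistable_def hypersurface_def)
  have "Q \<notin> moduli_point d f"
  proof
    assume "Q \<in> moduli_point d f"
    then have "eval (lookup f) (component e Q) = 0" unfolding moduli_point_def by blast
    with nz show False by (simp add: component_homogeneous[OF Q(2)])
  qed
  then show "moduli_point d f \<in> proj_basic_open (invariant_ring d) Q"
    using Q primeideal_moduli_point homogeneous_ideal_moduli_point
    by (auto simp: proj_basic_open_def proj_points_def)
qed

text \<open>With a root \<open>r\<close> of \<open>det g\<close> of order \<open>CARD('v)\<close>,
  \<open>g\<close> is \<open>r\<close> times a matrix of determinant 1; the scalar only multiplies
  the value of \<open>Q\<close> by the nonzero factor \<open>(r ^ d) ^ e\<close>.\<close>

lemma eval_invariant_pullback_invertible: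
  fixes g :: "complex ^ 'v::finite ^ 'v"
  assumes f: "homogeneous d f" and Q: "Q \<in> invariants d" "homogeneous e Q" and g: "det g \<noteq> 0"
  shows "eval (lookup (pullback g f)) Q \<noteq> 0 \<longleftrightarrow> eval (lookup f) Q \<noteq> 0"
proof -
  obtain r where r: "det g = r ^ CARD('v)"
    by (rule exists_complex_root[of "CARD('v)" "det g"]) simp_all
  with g have r0: "r \<noteq> 0" by auto
  define h where "h = (\<chi> i. (1 / r) *s g $ i)"
  have "det h = (\<Prod>i\<in>(UNIV::'v set). 1 / r) * det (\<chi> i. g $ i)"
    unfolding h_def by (rule det_rows_mul)
  also have "\<dots> = 1" using r r0 g by (simp add: power_one_over divide_simps)
  finally have h: "det h = 1" .
  have gh: "(g *v y) $ i = r * (h *v y) $ i" for y i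
    using r0 by (simp add: h_def matrix_vector_mult_def sum_distrib_left)
  have "pullback g f = single 0 (r ^ d) * pullback h f"
    by (rule mpoly_eval_eqI)
      (simp add: eval_pullback eval_simps gh eval_scale_homogeneous[OF f])
  then have "eval (lookup (pullback g f)) Q = eval (\<lambda>m. r ^ d * lookup (pullback h f) m) Q"
    by (simp add: fun_eq_iff flip: lookup_smult)
  also have "\<dots> = (r ^ d) ^ e * eval (lookup f) Q"
    by (simp add: eval_scale_homogeneous[OF Q(2)] invariantsD[OF Q(1) h f])
  finally show ?thesis using r0 by simp
qed

section \<open>The image of the map to moduli\<close>

text \<open>The basic open sets form a base and not merely a subbase: by primality two of them
  intersect in the one given by the product.\<close>

lemma generated_open_contains_basic_open:
  assumes "generate_topology_on {proj_basic_open (invariant_ring d) Q | Q e.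
      Q \<in> carrier (invariant_ring d) \<and> e > 0 \<and> homogeneous e Q} T" "P \<in> T"
  shows "\<exists>Q e. Q \<in> invariants d \<and> e > 0 \<and> homogeneous e Q \<and>
    P \<in> proj_basic_open (invariant_ring d) Q \<and> proj_basic_open (invariant_ring d) Q \<subseteq> T"
  using assms
proof (induction arbitrary: P rule: generate_topology_on.induct)
  case (Int a b)
  obtain Q e where Q: "Q \<in> invariants d" "e > 0" "homogeneous e Q"
    "P \<in> proj_basic_open (invariant_ring d) Q" "proj_basic_open (invariant_ring d) Q \<subseteq> a"
    using Int.IH(1)[of P] Int.prems by blast
  obtain Q' e' where Q': "Q' \<in> invariants d" "e' > 0" "homogeneous e' Q'"
    "P \<in> proj_basic_open (invariant_ring d) Q'" "proj_basic_open (invariant_ring d) Q' \<subseteq> b"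
    using Int.IH(2)[of P] Int.prems by blast
  have "Q * Q' \<in> P' \<longleftrightarrow> Q \<in> P' \<or> Q' \<in> P'" if "primeideal P' (invariant_ring d)" for P'
  proof -
    interpret primeideal P' "invariant_ring d" by (rule that)
    show ?thesis
      using I_prime[of Q Q'] I_l_closed[of Q' Q] I_r_closed[of Q Q'] Q(1) Q'(1) by auto
  qed
  then have "proj_basic_open (invariant_ring d) (Q * Q')
      = proj_basic_open (invariant_ring d) Q \<inter> proj_basic_open (invariant_ring d) Q'"
    by (auto simp: proj_basic_open_def proj_points_def)
  then show ?case
    using Q Q' by (intro exI[of _ "Q * Q'"] exI[of _ "e + e'"])
      (auto simp: invariants_mult homogeneous_mult)
next
  case (UN K)
  then obtain k where "k \<in> K" "P \<in> k" by blast
  with UN.IH[of k P] show ?case by blast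
next
  case (Basis s)
  then show ?case by auto
qed simp

lemma range_mem_grassmannian:
  fixes A :: "complex ^ 'k::finite ^ 'n::finite"
  assumes "inj ((*v) A)" "CARD('k) = k + 1"
  shows "range ((*v) A) \<in> grassmannian k"
proof -
  have lin: "Vector_Spaces.linear (*s) (*s) ((*v) A)" by (rule matrix_vector_mul_linear_gen)
  have "vec.subspace (range ((*v) A))"
    using vec.linear_subspace_image[OF lin vec.subspace_UNIV] .
  moreover have "vec.dim (range ((*v) A)) = k + 1"
  proof -
    have "vec.dim (range ((*v) A)) = vec.dim (UNIV :: (complex ^ 'k) set)"
    using vec.dim_image_eq[OF lin] assms(1) by (simp only: vec.span_UNIV)
    then show ?thesis by (simp only: vec_dim_card assms(2))
  qed
  ultimately show ?thesis by (simp add: grassmannian_def)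
qed

text \<open>\<open>linear_section\<close> chooses its own parametrisation \<open>A'\<close> of the
  range of \<open>A\<close>. The two differ by an invertible \<open>g\<close>, which preserves
  nonvanishing of \<open>Q\<close>.\<close>

lemma section_moduli_in_basic_open:
  fixes F :: "'n::finite mpoly" and A :: "complex ^ 'k::finite ^ 'n"
  assumes F: "homogeneous d F" and A: "inj ((*v) A)" and k: "CARD('k) = k + 1"
    and Q: "Q \<in> invariants d" "homogeneous e Q" "e > 0"
    and nz: "eval (lookup (pullback A F)) Q \<noteq> 0"
  shows "\<exists>y \<in> ran (section_moduli k d F). y \<in> proj_basic_open (invariant_ring d) Q"
proof -
  let ?L = "range ((*v) A)"
  define A' :: "complex ^ 'k ^ 'n" where "A' = (SOME A. inj ((*v) A) \<and> range ((*v) A) = ?L)"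
  have "inj ((*v) A') \<and> range ((*v) A') = ?L"
    unfolding A'_def by (rule someI[of _ A]) (use A in simp)
  then have A': "inj ((*v) A')" "range ((*v) A') = ?L" by blast+
  obtain B :: "complex ^ 'n ^ 'k" where B: "B ** A' = mat 1"
    using A'(1) matrix_left_invertible_injective by blast
  \<comment> \<open>As \<open>B\<close> is a left inverse of \<open>A'\<close> and the ranges agree,
    \<open>A' ** g = A\<close>.\<close>
  define g where "g = B ** A"
  have A'g: "A' *v (g *v y) = A *v y" for y
  proof -
    obtain z where z: "A *v y = A' *v z" using A'(2) by (metis rangeE rangeI)
    have "g *v y = B *v (A' *v z)" by (simp add: g_def z flip: matrix_vector_mul_assoc)
    also have "\<dots> = z" by (simp add: matrix_vector_mul_assoc B)
    finally show ?thesis using z by simp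
  qed
  then have AA': "A' ** g = A" by (simp add: matrix_eq flip: matrix_vector_mul_assoc)
  have "inj ((*v) g)" using A A'g by (metis injD injI)
  then have g: "det g \<noteq> 0"
    by (metis invertible_det_nz invertible_left_inverse matrix_left_invertible_injective)
  let ?f = "pullback A' F"
  have f: "homogeneous d ?f" by (rule homogeneous_pullback[OF F])
  have "pullback A F = pullback g ?f" by (simp add: pullback_pullback AA')
  then have fQ: "eval (lookup ?f) Q \<noteq> 0"
    using nz eval_invariant_pullback_invertible[OF f Q(1,2) g] by simp
  note ss = semistable_moduli_point[OF f Q fQ]
  have "?f \<noteq> 0" using ss(1) by (simp add: semistable_def hypersurface_def)
  then obtain y where "eval (\<lambda>j. y $ j) ?f \<noteq> 0"
    using mpoly_eval_eqI[of ?f 0] by (auto simp: eval_simps)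
  then have "A' *v y \<notin> zero_locus F" by (simp add: zero_locus_def eval_pullback)
  then have "\<not> ?L \<subseteq> zero_locus F" using A'(2) by blast
  moreover have "linear_section F ?L = ?f" by (simp add: linear_section_def A'_def)
  ultimately have "section_moduli k d F ?L = Some (moduli_point d ?f)"
    using ss(1) range_mem_grassmannian[OF A k] by (simp add: section_moduli_def Let_def)
  then have "moduli_point d ?f \<in> ran (section_moduli k d F)" by (rule ranI)
  with ss(2) show ?thesis by blast
qed

theorem theorem1p1:
  fixes d k n :: nat
    and X :: "('n::finite) mpoly"
  assumes "d > 0" and "k > 0"
    and "CARD('k::finite) = k + 1" and "CARD('n) = n + 1"
    and "smooth_hypersurface d X"
    and "n \<ge> ((d + k - 1) choose k) + k - 1"
  shows "(git_quotient d :: ('k coeff_poly) set topology)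
           closure_of (ran (section_moduli k d X)) = topspace (git_quotient d)"
proof
  let ?R = "invariant_ring d :: ('k coeff_poly) ring"
  have X: "homogeneous d X"
    using assms(5) by (simp add: smooth_hypersurface_def hypersurface_def)
  have "((d + k - 1) choose k) > 0" using \<open>d > 0\<close> by (simp add: zero_less_binomial_iff)
  then have kn: "k \<le> n" and bn: "((d + k - 1) choose k) \<le> n" using assms(2,6) by linarith+
  \<comment> \<open>The bound on \<open>n\<close> enters here: there are at most
    \<open>(d + k - 1) choose k\<close> monomials of degree \<open>d - 1\<close> in
    \<open>k + 1\<close> variables, which is less than the number \<open>n + 1\<close> of partial
    derivatives.\<close>
  have "card {m :: 'k monomial. mdeg m = d - 1} \<le> (d - 1 + CARD('k) - 1) choose (d - 1)"
    by (rule card_mdeg_eq_le)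
  also have "\<dots> = (d + k - 1) choose k"
    using \<open>d > 0\<close> binomial_symmetric[of k "d + k - 1"] by (simp add: assms(3))
  finally have card: "card {m :: 'k monomial. mdeg m = d - 1} \<le> CARD('n)"
    using bn assms(4) by simp
  \<comment> \<open>By Euler's identity a common zero of the partial derivatives lies on the
    hypersurface, where smoothness leaves only the origin.\<close>
  have nz: "\<exists>i. eval a (partial_deriv i X) \<noteq> 0" if "a j \<noteq> 0" for a j
  proof (rule ccontr)
    assume no: "\<nexists>i. eval a (partial_deriv i X) \<noteq> 0"
    let ?a = "\<chi> i. a i"
    have a: "($) ?a = a" by (rule ext) simp
    have "eval a X = 0" using euler_identity[OF X, of a] no \<open>d > 0\<close> by simp
    then have "?a \<in> zero_locus X" by (simp add: zero_locus_def a)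
    moreover have "?a \<noteq> 0" using that by (auto simp: vec_eq_iff)
    ultimately have "\<exists>i. eval (\<lambda>j. ?a $ j) (partial_deriv i X) \<noteq> 0"
      using assms(5) unfolding smooth_hypersurface_def by blast
    then show False using no by (simp add: a)
  qed
  obtain U :: "(complex ^ 'k ^ 'n) set" where U: "open U" "U \<noteq> {}"
    "\<And>A. A \<in> U \<Longrightarrow> inj ((*v) A)"
    "\<And>A m. A \<in> U \<Longrightarrow> mdeg m = d - 1 \<Longrightarrow>
       \<exists>x. single m 1 = (\<Sum>i\<in>UNIV. single 0 (x i) * pullback A (partial_deriv i X))"
  proof (rule spanning_pullbacks_exist[where e = "d - 1" and G = "\<lambda>i. partial_deriv i X" and 'k = 'k])
    show "homogeneous (d - 1) (partial_deriv i X)" for i by (rule homogeneous_partial_deriv[OF X])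
    show "\<exists>i. eval a (partial_deriv i X) \<noteq> 0" if "a j \<noteq> 0" for a j by (rule nz[of a j]) (rule that)
    show "CARD('k) \<le> CARD('n)" using kn assms(3,4) by simp
  qed (use card that in auto)
  show "topspace (git_quotient d :: ('k coeff_poly) set topology)
      \<subseteq> git_quotient d closure_of (ran (section_moduli k d X))"
    unfolding closure_of_def
  proof (intro subsetI CollectI conjI allI impI)
    fix P T assume "P \<in> T \<and> openin (git_quotient d :: ('k coeff_poly) set topology) T"
    then obtain Q e where Q: "Q \<in> invariants d" "e > 0" "homogeneous e Q"
      and P: "P \<in> proj_basic_open ?R Q" and T: "proj_basic_open ?R Q \<subseteq> T"
      using generated_open_contains_basic_open[of d T P]
      unfolding git_quotient_def Proj_def openin_topology_generated_by_iff by blast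
    \<comment> \<open>The prime \<open>P\<close> avoids \<open>Q\<close>, while every ideal contains
      0.\<close>
    have "Q \<noteq> 0"
    proof
      assume "Q = 0"
      moreover have "primeideal P ?R" "Q \<notin> P"
        using P by (simp_all add: proj_basic_open_def proj_points_def)
      ultimately show False
        using additive_subgroup.zero_closed[of P ?R]
        by (simp add: primeideal_def ideal_def)
    qed
    then obtain A where "A \<in> U" "eval (lookup (pullback A X)) Q \<noteq> 0"
      using coordinate_polynomial_nonvanishing[OF \<open>d > 0\<close> U(1,2,4) _ \<open>Q \<noteq> 0\<close>]
        invariants_coordinate_ring[OF Q(1)] by blast
    then show "\<exists>y\<in>ran (section_moduli k d X). y \<in> T"
      using section_moduli_in_basic_open[OF X U(3) assms(3) Q(1,3,2)] T by blast
  qed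
qed (rule closure_of_subset_topspace)

end
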